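(* Let $\alpha\in(0,1)$, $\delta\in(0,1-\alpha)$, $1\le k\le p$, and set $$\rho^2_{k,p,n}=\Big(1\wedge\frac{\log(1+8(1-\alpha-\delta)^2)}{2}\Big)\frac kn\log\Big(1+\frac{p}{k^2}+\sqrt{\frac{2p}{k^2}}\Big).$$ Suppose the covariance matrix of $X$ is the identity $I$ and $\mathrm{var}(Y)>0$ is known. Then for all $\rho<\rho_{k,p,n}$, $$\beta_I\Big(\Big\{\theta\in\Theta[k,p]:\frac{\|\theta\|^2}{\mathrm{var}(Y)-\|\theta\|^2}=\rho^2\Big\}\Big)>\delta.$$ Moreover, if $\alpha+\delta\le0.53$, then $\rho^2_{k,p,n}\ge\frac{k}{2n}\log\Big(1+\frac{p}{k^2}\vee\sqrt{\frac{p}{k^2}}\Big)$.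
   Context: Model: $Y=\sum_{i=1}^p\theta_iX_i+\epsilon$, where $\theta\in\mathbb R^p$, $X=(X_1,\dots,X_p)$ is a centered Gaussian vector with non-singular covariance matrix $\Sigma$, and $\epsilon$ is a centered Gaussian variable independent of $X$. $\|\theta\|^2:=\theta^T\Sigma\theta$. One observes $n$ i.i.d. copies of $(Y,X)$ giving $(\mathbf Y,\mathbf X)$. For given $\Sigma$ and a fixed value of $\mathrm{var}(Y)$, $\mathbb P_\theta$ is the law of $(\mathbf Y,\mathbf X)$ when the parameter is $\theta$ (so $\mathrm{var}(\epsilon)=\mathrm{var}(Y)-\|\theta\|^2$). For $\Theta\subset\mathbb R^p$, $\beta_\Sigma(\Theta)=\inf_{\psi_\alpha}\sup_{\theta\in\Theta}\mathbb P_\theta(\psi_\alpha=0)$, the infimum over all tests $\psi_\alpha\in\{0,1\}$ of the hypothesis $\theta=0$ with $\mathbb P_0(\psi_\alpha=1)\le\alpha$. $\Theta[k,p]$ is the set of $\theta\in\mathbb R^p$ with at most $k$ nonzero coordinates. *)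

theory Defs
  imports "HOL-Probability.Probability"
begin

text \<open>Parameters theta in R^p are represented as functions nat => real vanishing outside {..<p}.
  Since Sigma = I, the squared norm is the Euclidean one.\<close>

definition sqnorm :: "nat \<Rightarrow> (nat \<Rightarrow> real) \<Rightarrow> real" where
  "sqnorm p \<theta> = (\<Sum>j<p. (\<theta> j)\<^sup>2)"

definition Theta_sparse :: "nat \<Rightarrow> nat \<Rightarrow> (nat \<Rightarrow> real) set" where
  "Theta_sparse k p = {\<theta>. (\<forall>j\<ge>p. \<theta> j = 0) \<and> card {j. j < p \<and> \<theta> j \<noteq> 0} \<le> k}"

text \<open>Sample space for (Y,X): coordinate (i,0) is Y_i, coordinate (i, Suc j) is X_{i,j},
  for i < n, j < p.\<close>
definition obs_space :: "nat \<Rightarrow> nat \<Rightarrow> ((nat \<times> nat) \<Rightarrow> real) measure" where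
  "obs_space n p = PiM ({..<n} \<times> {..<Suc p}) (\<lambda>_. lborel)"

text \<open>Law P_theta of the n i.i.d. observations when Sigma = I and var(Y) = v:
  X_i ~ N(0, I_p), and Y_i given X_i is N(theta . X_i, v - |theta|^2).\<close>
definition P_law :: "real \<Rightarrow> nat \<Rightarrow> nat \<Rightarrow> (nat \<Rightarrow> real) \<Rightarrow> ((nat \<times> nat) \<Rightarrow> real) measure" where
  "P_law v n p \<theta> = density (obs_space n p)
     (\<lambda>\<omega>. ennreal (\<Prod>i<n.
        normal_density (\<Sum>j<p. \<theta> j * \<omega> (i, Suc j)) (sqrt (v - sqnorm p \<theta>)) (\<omega> (i, 0))
        * (\<Prod>j<p. std_normal_density (\<omega> (i, Suc j)))))"

text \<open>beta_I(Theta): infimum over level-alpha (non-randomized) tests, i.e. measurable rejection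
  regions A with P_0(A) <= alpha, of the maximal type II error sup_{theta in Theta} P_theta(psi = 0).\<close>
definition beta_I :: "real \<Rightarrow> nat \<Rightarrow> nat \<Rightarrow> real \<Rightarrow> (nat \<Rightarrow> real) set \<Rightarrow> real" where
  "beta_I v n p \<alpha> \<Theta> =
     (INF A \<in> {A. A \<in> sets (obs_space n p) \<and> measure (P_law v n p (\<lambda>_. 0)) A \<le> \<alpha>}.
        (SUP \<theta> \<in> \<Theta>. measure (P_law v n p \<theta>) (space (obs_space n p) - A)))"

definition rho2 :: "real \<Rightarrow> real \<Rightarrow> nat \<Rightarrow> nat \<Rightarrow> nat \<Rightarrow> real" where
  "rho2 \<alpha> \<delta> k p n = min 1 (ln (1 + 8 * (1 - \<alpha> - \<delta>)\<^sup>2) / 2) * (real k / real n)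
      * ln (1 + real p / (real k)\<^sup>2 + sqrt (2 * real p / (real k)\<^sup>2))"

end

theory Submission
  imports Defs
begin

text \<open>
  The alternative is mixed over the uniform prior on the vectors with exactly \<open>k\<close> nonzero coordinates
  \<open>\<plusminus>\<lambda>\<close>. For every test, (type I error) + (mixed type II error) is at least \<open>1 - \<surd>(\<chi>\<^sup>2)/2\<close>, where
  \<open>\<chi>\<^sup>2 + 1\<close> is the second moment of the mixed likelihood ratio under \<open>P\<^sub>0\<close>.

  For two parameters the cross moment of the likelihood ratios is \<open>(1 - \<langle>\<theta>, \<theta>'\<rangle>/v)\<^sup>-\<^sup>n\<close>: the pair
  \<open>(\<theta> \<sqdot> X, \<theta>' \<sqdot> X)\<close> is reduced by plane rotations to two independent standard normals, and by Bayes'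
  rule the single-observation moment is \<open>\<integral>\<integral> p\<^sub>\<theta>(x | y) p\<^sub>\<theta>'(y | x)\<close>, a Gaussian integral in \<open>y\<close>.

  Averaging over signs leaves only the even part of \<open>z \<mapsto> (1 - a z)\<^sup>-\<^sup>n\<close>. It is not bounded by
  \<open>cosh (n \<rho>\<^sup>2 z / k)\<close> when \<open>\<rho>\<close> is small, but it is bounded by \<open>cosh (n \<rho>\<^sup>2 z / (k \<surd>\<tau>))\<close>, where \<open>\<tau> < 1\<close> is the ratio of
  \<open>\<rho>\<^sup>2\<close> to \<open>(k/n) log (1 + p/k\<^sup>2 + \<surd>(2p/k\<^sup>2))\<close>. The loss of \<open>1/\<surd>\<tau>\<close> is affordable: as \<open>cosh (u L) - 1 \<le> u\<^sup>2 (cosh L - 1)\<close>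
  for \<open>0 \<le> u \<le> 1\<close>, the hypergeometric average over supports is still at most \<open>exp \<tau>\<close>, which is less
  than \<open>1 + 4 (1 - \<alpha> - \<delta>)\<^sup>2\<close>.
\<close>

subsection \<open>Hyperbolic inequalities\<close>

lemma cosh_ge_one_plus_half_square: "1 + x\<^sup>2 / 2 \<le> cosh (x::real)"
proof -
  have "\<bar>x/2\<bar> \<le> \<bar>sinh (x/2)\<bar>"
    using real_le_abs_sinh[of "x/2"] by (simp add: sinh_field_def exp_minus)
  then have "(x/2)\<^sup>2 \<le> (sinh (x/2))\<^sup>2"
    by (simp only: abs_le_square_iff)
  moreover have "cosh x = 1 + 2 * (sinh (x/2))\<^sup>2"
    using cosh_double[of "x/2"] cosh_square_eq[of "x/2"] by simp
  ultimately show ?thesis by (simp add: power2_eq_square)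
qed

text \<open>The function \<open>ln cosh\<close> is convex with derivative \<open>tanh\<close>, and
  this is its tangent inequality at \<open>y\<close> in exponential form. It is Jensen for
  \<open>exp\<close> at \<open>h\<close> and \<open>-h\<close> with weights \<open>(1 + T)/2\<close>
  and \<open>(1 - T)/2\<close>: the mean is \<open>h * T\<close>, and the averaged exponential is
  \<open>cosh (y + h) / cosh y\<close>.\<close>

lemma cosh_add_ge_exp_tanh:
  "cosh y * exp (h * tanh y) \<le> cosh (y + h)" for y h :: real
proof -
  define T where "T = tanh y"
  have T: "-1 < T" "T < 1"
    using tanh_real_bounds[of y] by (auto simp: T_def)
  have "exp ((1 - (1 - T)/2) *\<^sub>R h + ((1 - T)/2) *\<^sub>R (-h))
      \<le> (1 - (1 - T)/2) * exp h + ((1 - T)/2) * exp (-h)"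
    using T by (intro convex_onD[OF exp_convex]) auto
  also have "(1 - (1 - T)/2) *\<^sub>R h + ((1 - T)/2) *\<^sub>R (-h) = h * T"
    by (simp add: field_simps)
  also have "(1 - (1 - T)/2) * exp h + ((1 - T)/2) * exp (-h) = cosh h + T * sinh h"
    by (simp add: cosh_field_def sinh_field_def field_simps)
  finally have "cosh y * exp (h * T) \<le> cosh y * (cosh h + T * sinh h)"
    by (intro mult_left_mono) auto
  also have "\<dots> = cosh (y + h)"
    by (simp add: cosh_add T_def tanh_def field_simps)
  finally show ?thesis by (simp add: T_def)
qed

text \<open>The slope \<open>2/3 = 1/2 + 1/6\<close> is what the error terms in
  \<open>even_part_le_cosh_large_n\<close> add up to. With \<open>tanh y = (E - 1)/(E + 1)\<close>
  the claim is linear in \<open>E = exp (2 * y)\<close>, so a quadratic Taylor bound on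
  \<open>E\<close> is enough.\<close>

lemma tanh_ge_two_thirds:
  assumes "0 \<le> (y::real)" "y \<le> 1"
  shows "2 / 3 * y \<le> tanh y"
proof -
  define E where "E = exp (2 * y)"
  have E: "1 + 2 * y + 2 * y\<^sup>2 \<le> E"
    using exp_lower_Taylor_quadratic[of "2*y"] assms by (simp add: E_def power_mult_distrib)
  have "tanh y = (E - 1) / (E + 1)"
  proof -
    have "exp (- 2 * y) = 1 / E" by (simp add: E_def exp_minus field_simps)
    moreover have "E > 0" by (simp add: E_def)
    moreover have "(1 - 1 / E) / (1 + 1 / E) = (E - 1) / (E + 1)"
    proof -
      have "1 - 1 / E = (E - 1) / E" "1 + 1 / E = (E + 1) / E"
        using \<open>E > 0\<close> by (simp_all add: field_simps)
      then show ?thesis using \<open>E > 0\<close> by simp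
    qed
    ultimately show ?thesis by (simp only: tanh_real_altdef)
  qed
  moreover have "2 / 3 * y * (E + 1) \<le> E - 1"
  proof -
    have "y\<^sup>2 \<le> 1 * y" unfolding power2_eq_square using assms by (intro mult_right_mono) auto
    then have sq: "y\<^sup>2 \<le> y" by simp
    have "(1 - 2/3*y) * (1 + 2 * y + 2 * y\<^sup>2) \<le> (1 - 2/3*y) * E"
      using E assms by (intro mult_left_mono) auto
    moreover have "(1 - 2/3*y) * (1 + 2 * y + 2 * y\<^sup>2) = 1 + 2/3*y + 2/3*(y + y\<^sup>2 - 2 * y * y\<^sup>2)"
      by (simp add: field_simps power2_eq_square)
    moreover have "2 * y * y\<^sup>2 \<le> y + y\<^sup>2"
    proof -
      have "y * y\<^sup>2 \<le> y * y" "y * y\<^sup>2 \<le> 1 * y\<^sup>2" 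
        using mult_left_mono[OF sq assms(1)] mult_right_mono[OF assms(2) zero_le_power2[of y]]
        by (simp_all only: )
      then show ?thesis using sq by (simp add: power2_eq_square)
    qed
    ultimately have "1 + 2/3*y \<le> (1 - 2/3*y) * E"
      by (smt (verit) divide_nonneg_pos mult_nonneg_nonneg)
    also have "\<dots> = E - 2/3*y*E" by (simp add: left_diff_distrib)
    finally show ?thesis by (simp add: distrib_left)
  qed
  moreover have "E + 1 > 0" by (simp add: E_def add_pos_pos)
  ultimately show ?thesis by (simp add: pos_le_divide_eq)
qed

text \<open>The hypothesis \<open>x * (1 + r) \<le> r\<close> says
  \<open>1 / (1 - x) \<le> 1 + r\<close>. The remainder of \<open>- ln (1 - t)\<close> after
  \<open>t + t\<^sup>2 / 2\<close> has derivative \<open>t\<^sup>2 / (1 - t)\<close>, hence at most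
  \<open>(1 + r) * t\<^sup>2\<close> on \<open>[0, x]\<close>.\<close>

lemma inverse_one_minus_le_exp_cubic:
  assumes "0 \<le> (x::real)" "x * (1 + r) \<le> r" "0 \<le> r"
  shows "1 / (1 - x) \<le> exp (x + x\<^sup>2 / 2 + x^3 * (1 + r) / 3)"
proof -
  have x1: "x < 1"
  proof (rule ccontr)
    assume "\<not> x < 1"
    then have "1 * (1 + r) \<le> x * (1 + r)" using assms by (intro mult_right_mono) auto
    with assms(2) have "1 + r \<le> r" by (simp only: mult_1)
    then show False by simp
  qed
  define f where "f = (\<lambda>t::real. t + t\<^sup>2 / 2 + t^3 * (1 + r) / 3 + ln (1 - t))"
  have "f 0 \<le> f x"
  proof (rule DERIV_nonneg_imp_nondecreasing[OF assms(1)])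
    fix t assume t: "0 \<le> t" "t \<le> x"
    have d: "(f has_real_derivative (1 + t + t\<^sup>2 * (1 + r) - 1 / (1 - t))) (at t)"
      unfolding f_def using t x1
      by (auto intro!: derivative_eq_intros simp: field_simps power2_eq_square)
    have "t * (1 + r) \<le> r" 
      using mult_right_mono[of t x "1 + r"] t assms by linarith
    then have "1 \<le> (1 + r) * (1 - t)" by (simp add: algebra_simps)
    then have "t\<^sup>2 * 1 \<le> t\<^sup>2 * ((1 + r) * (1 - t))" by (intro mult_left_mono) auto
    then have "0 \<le> 1 + t + t\<^sup>2 * (1 + r) - 1 / (1 - t)"
      using t x1 by (simp add: field_simps power2_eq_square)
    with d show "\<exists>y. (f has_real_derivative y) (at t) \<and> 0 \<le> y" by blast
  qed
  then have "- ln (1 - x) \<le> x + x\<^sup>2 / 2 + x^3 * (1 + r) / 3" by (simp add: f_def)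
  then have "exp (- ln (1 - x)) \<le> exp (x + x\<^sup>2 / 2 + x^3 * (1 + r) / 3)" by simp
  then show ?thesis using x1 by (simp add: exp_minus inverse_eq_divide)
qed

lemma inverse_one_plus_le_exp_quadratic:
  assumes "0 \<le> (x::real)"
  shows "1 / (1 + x) \<le> exp (- x + x\<^sup>2 / 2)"
proof -
  define f where "f = (\<lambda>t::real. - t + t\<^sup>2 / 2 + ln (1 + t))"
  have "f 0 \<le> f x"
  proof (rule DERIV_nonneg_imp_nondecreasing[OF assms])
    fix t assume t: "0 \<le> t" "t \<le> x"
    have d: "(f has_real_derivative (- 1 + t + 1 / (1 + t))) (at t)"
      unfolding f_def using t
      by (auto intro!: derivative_eq_intros simp: field_simps power2_eq_square)
    have "0 \<le> - 1 + t + 1 / (1 + t)"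
      using t by (simp add: field_simps power2_eq_square)
    with d show "\<exists>y. (f has_real_derivative y) (at t) \<and> 0 \<le> y" by blast
  qed
  then have "- ln (1 + x) \<le> - x + x\<^sup>2 / 2" by (simp add: f_def)
  then have "exp (- ln (1 + x)) \<le> exp (- x + x\<^sup>2 / 2)" by simp
  then show ?thesis using assms by (simp add: exp_minus inverse_eq_divide)
qed

text \<open>Both factors are at most \<open>exp (\<plusminus>x + d)\<close> with a common
  \<open>d\<close>, so the even part is at most \<open>exp (n * d) * cosh (n * x)\<close>. The
  tangent inequality for \<open>ln cosh\<close> absorbs \<open>exp (n * d)\<close> into a shift of
  the argument by \<open>r' * n * x\<close>, as soon as
  \<open>d \<le> r' * x * tanh (n * x)\<close>.\<close>

lemma even_part_le_cosh_large_n: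
  fixes x r r' :: real and n :: nat
  assumes x: "0 \<le> x" "x * (1 + r) \<le> r" and r: "0 \<le> r" "r \<le> 1/2" and r': "r \<le> r'" "1 \<le> real n * r'"
  shows "((1 / (1 - x)) ^ n + (1 / (1 + x)) ^ n) / 2 \<le> cosh (real n * x * (1 + r'))"
proof -
  define d where "d = x\<^sup>2 / 2 + x^3 * (1 + r) / 3"
  have xr: "x \<le> r" 
    using x(2) mult_nonneg_nonneg[OF x(1) r(1)] unfolding distrib_left by linarith
  have x1: "x < 1" using xr r by simp
  have "1 / (1 - x) \<le> exp (x + d)"
    using inverse_one_minus_le_exp_cubic[OF x r(1)] by (simp add: d_def add.assoc)
  then have 1: "(1 / (1 - x)) ^ n \<le> exp (real n * (x + d))"
    using x1 by (subst exp_of_nat_mult, intro power_mono) auto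
  have "1 / (1 + x) \<le> exp (- x + d)"
    using x r by (intro order_trans[OF inverse_one_plus_le_exp_quadratic]) (auto simp: d_def)
  then have 2: "(1 / (1 + x)) ^ n \<le> exp (real n * (- x + d))"
    using x by (subst exp_of_nat_mult, intro power_mono) auto
  let ?y = "real n * x"
  have "((1 / (1 - x)) ^ n + (1 / (1 + x)) ^ n) / 2 \<le> (exp (real n * (x + d)) + exp (real n * (- x + d))) / 2"
    using 1 2 by simp
  also have "\<dots> = exp (real n * d) * cosh ?y"
  proof -
    have "exp (real n * (x + d)) = exp (real n * d) * exp ?y"
      "exp (real n * (- x + d)) = exp (real n * d) * exp (- ?y)"
      by (simp_all only: exp_add[symmetric] distrib_left) (simp_all add: algebra_simps)
    then show ?thesis by (simp add: cosh_field_def distrib_left add_divide_distrib)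
  qed
  also have "\<dots> \<le> exp (r' * ?y * tanh ?y) * cosh ?y"
  proof -
    \<comment> \<open>For \<open>n * x \<le> 1\<close> the linear bound on \<open>tanh\<close> is
      combined with \<open>n * r' \<ge> 1\<close>; beyond that \<open>tanh\<close> already exceeds
      \<open>2/3\<close>, and \<open>x \<le> r \<le> r'\<close> finishes.\<close>
    have "2 / 3 * x \<le> r' * tanh ?y"
    proof (cases "?y \<le> 1")
      case True
      have "2 / 3 * x * 1 \<le> 2 / 3 * x * (real n * r')" using x r' by (intro mult_left_mono) auto
      also have "\<dots> = r' * (2 / 3 * ?y)" by simp
      also have "\<dots> \<le> r' * tanh ?y"
        using True x r r' by (intro mult_left_mono tanh_ge_two_thirds) auto
      finally show ?thesis by simp
    next
      case False
      have "2 / 3 * 1 \<le> tanh (1::real)" by (rule tanh_ge_two_thirds) auto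
      also have "\<dots> \<le> tanh ?y" using False by simp
      finally have "x * (2/3) \<le> r' * tanh ?y" using x xr r' r by (intro mult_mono) auto
      then show ?thesis by simp
    qed
    moreover have "x\<^sup>2 * (1 + r) / 3 \<le> x / 6"
    proof -
      have "x * (x * (1 + r)) \<le> x * (1/2)" using x r by (intro mult_left_mono) auto
      then show ?thesis by (simp add: power2_eq_square algebra_simps)
    qed
    ultimately have "x / 2 + x\<^sup>2 * (1 + r) / 3 \<le> r' * tanh ?y" by linarith
    then have "?y * (x / 2 + x\<^sup>2 * (1 + r) / 3) \<le> ?y * (r' * tanh ?y)"
      using x by (intro mult_left_mono) auto
    moreover have "?y * (x / 2 + x\<^sup>2 * (1 + r) / 3) = real n * d"
      by (simp add: d_def field_simps power2_eq_square power3_eq_cube)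
    ultimately show ?thesis by (intro mult_right_mono) (auto simp: algebra_simps)
  qed
  also have "\<dots> \<le> cosh (?y + r' * ?y)"
    using cosh_add_ge_exp_tanh[of ?y "r' * ?y"] by (simp add: mult.commute)
  finally show ?thesis by (simp add: algebra_simps)
qed

text \<open>The relation \<open>P + Q = 2 * (P * Q)\<close> says \<open>1/P + 1/Q = 2\<close>, as
  for \<open>1 / (1 - x)\<close> and \<open>1 / (1 + x)\<close>. It turns the case
  \<open>n = 1\<close> into the hypothesis \<open>P * Q \<le> cosh s\<close>, and the lemma carries
  this case to all powers.\<close>

lemma power_mean_le_cosh:
  fixes P Q s :: real and n :: nat
  assumes P: "0 < P" and Q: "0 < Q" and PQ: "P + Q = 2 * (P * Q)" "1 \<le> P * Q" "P * Q \<le> cosh s"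
  shows "(P ^ n + Q ^ n) / 2 \<le> cosh (real n * s)"
proof -
  define E where "E = (\<lambda>n. (P ^ n + Q ^ n) / 2)"
  define C where "C = (\<lambda>n. cosh (real n * s))"
  have Epos: "0 < E n" for n using P Q by (simp add: E_def add_pos_pos)
  have Cpos: "0 < C n" for n by (simp add: C_def)
  have Erec: "E (Suc (Suc n)) = 2 * (P*Q) * E (Suc n) - (P*Q) * E n" for n
  proof -
    have "E (Suc (Suc n)) = (P + Q) * E (Suc n) - (P*Q) * E n"
      by (simp add: E_def field_simps)
    then show ?thesis by (simp add: PQ(1))
  qed
  have Crec: "C (Suc (Suc n)) = 2 * cosh s * C (Suc n) - C n" for n
  proof -
    have "C (Suc (Suc n)) = cosh (real (Suc n) * s + s)" "C n = cosh (real (Suc n) * s - s)"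
      by (simp_all add: C_def algebra_simps)
    then show ?thesis by (simp add: cosh_add cosh_diff C_def)
  qed
  \<comment> \<open>Both sides satisfy three-term recurrences; comparing consecutive ratios makes the induction go through.\<close>
  have ratio: "E (Suc n) * C n \<le> C (Suc n) * E n" for n
  proof (induction n)
    case 0
    then show ?case using PQ by (simp add: E_def C_def)
  next
    case (Suc n)
    have "E (Suc (Suc n)) * C (Suc n) = 2 * (P*Q) * E (Suc n) * C (Suc n) - (P*Q) * (E n * C (Suc n))"
      by (simp add: Erec algebra_simps)
    also have "\<dots> \<le> 2 * cosh s * E (Suc n) * C (Suc n) - 1 * (E (Suc n) * C n)"
    proof (rule diff_mono)
      show "2 * (P*Q) * E (Suc n) * C (Suc n) \<le> 2 * cosh s * E (Suc n) * C (Suc n)"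
        using PQ(3) Epos[of "Suc n"] Cpos[of "Suc n"] by (intro mult_right_mono) auto
      \<comment> \<open>The subtracted terms compare in the opposite direction: this is the
        induction hypothesis, enlarged on the right by \<open>P * Q \<ge> 1\<close>.\<close>
      show "1 * (E (Suc n) * C n) \<le> (P*Q) * (E n * C (Suc n))"
        using Suc PQ(2) Epos[of "Suc n"] Cpos[of n] P Q
        mult_mono[of 1 "P * Q" "E (Suc n) * C n" "E n * C (Suc n)"]
        by (auto simp: mult.commute)
    qed
    also have "\<dots> = C (Suc (Suc n)) * E (Suc n)" by (simp add: Crec algebra_simps)
    finally show ?case .
  qed
  \<comment> \<open>The consecutive ratios of \<open>E\<close> are bounded by those of
    \<open>C\<close>, and \<open>E 0 = C 0 = 1\<close>.\<close>
  have "E n \<le> C n"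
  proof (induction n)
    case 0
    then show ?case by (simp add: E_def C_def)
  next
    case (Suc n)
    have "E (Suc n) * C n \<le> C (Suc n) * C n"
      using ratio[of n] Suc Cpos[of "Suc n"] by (meson less_imp_le mult_left_mono order_trans)
    then show ?case using Cpos[of n] by simp
  qed
  then show ?thesis by (simp add: E_def C_def)
qed

text \<open>Two regimes. If \<open>r \<ge> \<tau> - 1/2\<close>, the case \<open>n = 1\<close>
  already holds with argument \<open>c / sqrt \<tau>\<close>, and \<open>power_mean_le_cosh\<close>
  lifts it to every \<open>n\<close>. Otherwise \<open>r\<close> is below \<open>1/2\<close>, and
  \<open>n * r \<ge> \<tau>\<close> makes \<open>n\<close> large enough for the Taylor
  estimate.\<close>

lemma even_part_le_cosh:
  fixes c r \<tau> :: real and n :: nat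
  assumes c: "0 \<le> c" "c \<le> r" and \<tau>: "0 < \<tau>" "\<tau> \<le> 1" and nr: "\<tau> \<le> real n * r"
  shows "((1 / (1 - c / (1 + r))) ^ n + (1 / (1 + c / (1 + r))) ^ n) / 2 \<le> cosh (real n * c / sqrt \<tau>)"
proof (cases "\<tau> - 1/2 \<le> r")
  case True
  define x where "x = c / (1 + r)"
  have x: "0 \<le> x" "x < 1" "c = x * (1 + r)" using c by (auto simp: x_def field_simps)
  have x2: "0 < 1 - x\<^sup>2" using x by (simp add: abs_square_less_1)
  define P where "P = 1 / (1 - x)"
  define Q where "Q = 1 / (1 + x)"
  have PQ: "P * Q = 1 / (1 - x\<^sup>2)" by (simp add: P_def Q_def power2_eq_square algebra_simps)
  have "1 / (1 - x\<^sup>2) \<le> 1 + c\<^sup>2 / (2 * \<tau>)"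
  proof -
    have "c\<^sup>2 \<le> r\<^sup>2" using c by (simp add: power_mono)
    \<comment> \<open>Since \<open>c \<le> r\<close>, the right side is at least
      \<open>1 + 2 * r\<close>, which the case assumption bounds below by
      \<open>2 * \<tau>\<close>.\<close>
    then have A: "2 * \<tau> \<le> (1 + r)\<^sup>2 - c\<^sup>2" using True by (simp add: power2_eq_square algebra_simps)
    have "1 / (1 - x\<^sup>2) = 1 + c\<^sup>2 / ((1 + r)\<^sup>2 - c\<^sup>2)"
    proof -
      have "x\<^sup>2 = c\<^sup>2 / (1 + r)\<^sup>2" by (simp add: x_def power_divide)
      moreover have "(1 + r)\<^sup>2 > 0" using c by simp
      moreover have "(1 + r)\<^sup>2 - c\<^sup>2 > 0" using A \<tau> by simp
      ultimately show ?thesis using x2 by (simp add: divide_simps) (simp add: algebra_simps)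
    qed
    also have "\<dots> \<le> 1 + c\<^sup>2 / (2 * \<tau>)"
      using A \<tau> by (intro add_left_mono divide_left_mono) auto
    finally show ?thesis .
  qed
  also have "\<dots> \<le> cosh (c / sqrt \<tau>)"
    using cosh_ge_one_plus_half_square[of "c / sqrt \<tau>"] \<tau> by (simp add: power_divide mult.commute)
  finally have "P * Q \<le> cosh (c / sqrt \<tau>)" by (simp add: PQ)
  moreover have "P + Q = 2 * (P * Q)" using x by (simp add: P_def Q_def field_simps)
  moreover have "1 \<le> P * Q" using x2 by (simp add: PQ)
  ultimately have "(P ^ n + Q ^ n) / 2 \<le> cosh (real n * (c / sqrt \<tau>))"
    using x by (intro power_mean_le_cosh) (auto simp: P_def Q_def)
  then show ?thesis by (simp add: P_def Q_def x_def)
next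
  case False
  \<comment> \<open>Chosen so that \<open>c / (1 + r) * (1 + r')\<close> equals the target
    \<open>c / sqrt \<tau>\<close>.\<close>
  define r' where "r' = (1 + r) / sqrt \<tau> - 1"
  have rpos: "0 \<le> r" using c by simp
  \<comment> \<open>The convex function \<open>1 / sqrt \<tau>\<close> lies above its tangent at
    \<open>\<tau> = 1\<close>; in \<open>u = sqrt \<tau>\<close> the gap has the factor
    \<open>(1 - u)\<^sup>2 * (2 + u)\<close>.\<close>
  have sq: "1 + (1 - \<tau>) / 2 \<le> 1 / sqrt \<tau>"
  proof -
    define u where "u = sqrt \<tau>"
    have u: "0 < u" "\<tau> = u\<^sup>2" using \<tau> by (auto simp: u_def)
    have "0 \<le> (1 - u)\<^sup>2 * (2 + u)" using u by auto
    then show ?thesis unfolding u_def[symmetric] using u by (simp add: field_simps power2_eq_square)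
  qed
  have "(1 + r) * (1 + (1 - \<tau>) / 2) \<le> (1 + r) * (1 / sqrt \<tau>)"
    using sq rpos by (intro mult_left_mono) auto
  then have "r + (1 - \<tau>) / 2 + r * ((1 - \<tau>) / 2) \<le> r'" 
  proof -
    have "(1 + r) * (1 + (1 - \<tau>) / 2) = 1 + (r + (1 - \<tau>) / 2 + r * ((1 - \<tau>) / 2))"
      by (simp add: field_simps)
    moreover have "(1 + r) * (1 / sqrt \<tau>) = 1 + r'" by (simp add: r'_def)
    ultimately show ?thesis
      using \<open>(1 + r) * (1 + (1 - \<tau>) / 2) \<le> (1 + r) * (1 / sqrt \<tau>)\<close> by linarith
  qed
  moreover have "0 \<le> r * ((1 - \<tau>) / 2)" using rpos \<tau> by auto
  ultimately have r': "r + (1 - \<tau>) / 2 \<le> r'" by simp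
  have n2: "2 \<le> n"
  proof (rule ccontr)
    assume "\<not> 2 \<le> n"
    then have "real n \<le> 1" by simp
    then have "real n * r \<le> 1 * r" using rpos by (intro mult_right_mono) auto
    then show False using False nr by simp
  qed
  \<comment> \<open>The term \<open>n * r\<close> supplies \<open>\<tau>\<close>, and
    \<open>n \<ge> 2\<close> supplies the missing \<open>1 - \<tau>\<close>.\<close>
  have "1 \<le> real n * r'"
  proof -
    have "2 * ((1 - \<tau>) / 2) \<le> real n * ((1 - \<tau>) / 2)" using n2 \<tau> by (intro mult_right_mono) auto
    then have "1 \<le> real n * (r + (1 - \<tau>) / 2)" using nr by (simp add: distrib_left)
    also have "\<dots> \<le> real n * r'" using r' by (intro mult_left_mono) auto
    finally show ?thesis .
  qed
  moreover have "r \<le> r'"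
  proof -
    have "0 \<le> (1 - \<tau>) / 2" using \<tau> by simp
    with r' show ?thesis by linarith
  qed
  moreover have "c / (1 + r) * (1 + r) \<le> r" using c by simp
  ultimately have "((1 / (1 - c / (1 + r))) ^ n + (1 / (1 + c / (1 + r))) ^ n) / 2
      \<le> cosh (real n * (c / (1 + r)) * (1 + r'))"
    using c False \<tau> by (intro even_part_le_cosh_large_n) auto
  also have "real n * (c / (1 + r)) * (1 + r') = real n * c / sqrt \<tau>"
  proof -
    have "1 + r' = (1 + r) / sqrt \<tau>" by (simp add: r'_def)
    then show ?thesis using rpos by simp
  qed
  finally show ?thesis .
qed

text \<open>As \<open>cosh z - 1\<close> is twice the square of
  \<open>sinh (\<bar>z\<bar> / 2)\<close>, convexity of \<open>sinh\<close> on the half-line with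
  \<open>sinh 0 = 0\<close> gives one factor \<open>u\<close> before squaring. The quadratic gain
  matters: with \<open>u = sqrt \<tau>\<close> it yields a full factor
  \<open>\<tau>\<close>.\<close>

lemma cosh_mult_minus_one_le:
  fixes u L :: real
  assumes u: "0 \<le> u" "u \<le> 1"
  shows "cosh (u * L) - 1 \<le> u\<^sup>2 * (cosh L - 1)"
proof -
  have sinh_conv: "sinh (u * y) \<le> u * sinh y" if "0 \<le> y" for y :: real
  proof -
    have "convex_on {0..} (sinh :: real \<Rightarrow> real)"
      by (rule f''_ge0_imp_convex[where f' = cosh and f'' = sinh])
         (auto intro!: derivative_eq_intros)
    then have "sinh ((1 - u) *\<^sub>R 0 + u *\<^sub>R y) \<le> (1 - u) * sinh 0 + u * sinh y"
      using u that by (intro convex_onD) auto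
    then show ?thesis by simp
  qed
  have c: "cosh z - 1 = 2 * (sinh (\<bar>z\<bar>/2))\<^sup>2" for z :: real
  proof -
    have "cosh \<bar>z\<bar> = 1 + 2 * (sinh (\<bar>z\<bar>/2))\<^sup>2"
      using cosh_double[of "\<bar>z\<bar>/2"] cosh_square_eq[of "\<bar>z\<bar>/2"] by simp
    then show ?thesis by simp
  qed
  have "sinh (\<bar>u * L\<bar>/2) \<le> u * sinh (\<bar>L\<bar>/2)"
    using sinh_conv[of "\<bar>L\<bar>/2"] u by (simp add: abs_mult)
  then have "(sinh (\<bar>u * L\<bar>/2))\<^sup>2 \<le> (u * sinh (\<bar>L\<bar>/2))\<^sup>2"
    by (intro power_mono) auto
  then show ?thesis unfolding c by (simp add: power_mult_distrib)
qed

text \<open>The exact solution of \<open>cosh L = 1 + q\<close> is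
  \<open>L = ln (1 + q + sqrt (2 * q + q\<^sup>2))\<close>; dropping \<open>q\<^sup>2\<close> under
  the root only decreases it. This explains the logarithm in \<open>rho2\<close>, with
  \<open>q = p / k\<^sup>2\<close>.\<close>

lemma cosh_ln_one_plus_le:
  assumes "0 \<le> (q::real)"
  shows "cosh (ln (1 + q + sqrt (2 * q))) - 1 \<le> q"
proof -
  define s where "s = sqrt (2 * q)"
  have s: "0 \<le> s" "s\<^sup>2 = 2 * q" using assms by (auto simp: s_def)
  define E where "E = 1 + q + s"
  have E: "0 < E" using assms s by (simp add: E_def)
  have "E\<^sup>2 + 1 \<le> 2 * (1 + q) * E"
  proof -
    have "2 * (1 + q) * E - (E\<^sup>2 + 1) = q\<^sup>2 + (2 * q - s\<^sup>2)"
      by (simp add: E_def power2_eq_square algebra_simps)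
    then show ?thesis using s zero_le_power2[of q] by linarith
  qed
  then have "(E + inverse E) / 2 \<le> 1 + q" using E by (simp add: field_simps power2_eq_square)
  then have "cosh (ln E) \<le> 1 + q" using E by (simp add: cosh_ln_real)
  then show ?thesis by (simp add: E_def s_def)
qed

text \<open>This provides the hypothesis \<open>\<tau> \<le> n * r\<close> of
  \<open>even_part_le_cosh\<close>. With \<open>y = 1/k\<close>, the bound \<open>k \<le> p\<close>
  gives \<open>p / k\<^sup>2 \<ge> y\<close>, and \<open>exp y \<le> 1 + y + y\<^sup>2\<close> stays
  below the argument of the logarithm because \<open>y\<^sup>2 \<le> sqrt (2 * y)\<close> for
  \<open>y \<le> 1\<close>.\<close>

lemma one_le_mult_ln_critical:
  fixes k p :: nat
  assumes "1 \<le> k" "k \<le> p"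
  shows "1 \<le> real k * ln (1 + real p / (real k)\<^sup>2 + sqrt (2 * real p / (real k)\<^sup>2))"
proof -
  define y where "y = 1 / real k"
  have y: "0 < y" "y \<le> 1" using assms by (auto simp: y_def)
  have "real k / (real k)\<^sup>2 \<le> real p / (real k)\<^sup>2" using assms by (intro divide_right_mono) auto
  then have q: "y \<le> real p / (real k)\<^sup>2" using assms by (simp add: y_def power2_eq_square)
  have "exp y \<le> 1 + y + y\<^sup>2" using y by (intro exp_bound) auto
  also have "y\<^sup>2 \<le> sqrt (2 * y)"
  proof (rule real_le_rsqrt)
    have "(y\<^sup>2)\<^sup>2 \<le> y ^ 1" using y unfolding power_mult[symmetric] by (intro power_decreasing) auto
    then show "(y\<^sup>2)\<^sup>2 \<le> 2 * y" using y by simp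
  qed
  also have "sqrt (2 * y) \<le> sqrt (2 * real p / (real k)\<^sup>2)" using q by simp
  finally have "exp y \<le> 1 + real p / (real k)\<^sup>2 + sqrt (2 * real p / (real k)\<^sup>2)" using q by linarith
  then have "ln (exp y) \<le> ln (1 + real p / (real k)\<^sup>2 + sqrt (2 * real p / (real k)\<^sup>2))"
    by (subst ln_le_cancel_iff) (auto simp: add_nonneg_nonneg add_pos_nonneg)
  then show ?thesis using assms by (simp add: y_def field_simps)
qed

subsection \<open>Averages over signs and supports\<close>

text \<open>A sign vector is encoded by the set \<open>T\<close> of its positive coordinates, so
  averages over signs become sums over \<open>Pow {..<p}\<close>.\<close>

definition sign_in :: "nat set \<Rightarrow> nat \<Rightarrow> real" where
  "sign_in T j = (if j \<in> T then 1 else -1)"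

text \<open>Expanding the product of the sums \<open>exp (a j) + exp (- a j)\<close> picks one
  summand per coordinate, that is, one sign vector. Up to the factor \<open>2 ^ p\<close> this is
  the moment generating function of a Rademacher sum.\<close>

lemma sum_exp_signs:
  fixes a :: "nat \<Rightarrow> real"
  shows "(\<Sum>T\<in>Pow {..<p}. exp (\<Sum>j<p. sign_in T j * a j)) = (\<Prod>j<p. 2 * cosh (a j))"
proof -
  have "(\<Prod>j<p. 2 * cosh (a j)) = (\<Prod>j<p. exp (a j) + exp (- a j))"
    by (intro prod.cong) (simp_all add: cosh_field_def)
  also have "\<dots> = (\<Sum>T\<in>Pow {..<p}. (\<Prod>j\<in>T. exp (a j)) * (\<Prod>j\<in>{..<p} - T. exp (- a j)))"
    by (rule prod_add) simp
  also have "\<dots> = (\<Sum>T\<in>Pow {..<p}. exp (\<Sum>j<p. sign_in T j * a j))"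
  proof (rule sum.cong[OF refl])
    fix T assume "T \<in> Pow {..<p}"
    then have T: "T \<subseteq> {..<p}" by simp
    have fin: "finite T" using T finite_subset by blast
    have "(\<Prod>j\<in>T. exp (a j)) = exp (\<Sum>j\<in>T. sign_in T j * a j)"
      using fin by (simp add: exp_sum sign_in_def)
    moreover have "(\<Prod>j\<in>{..<p} - T. exp (- a j)) = exp (\<Sum>j\<in>{..<p} - T. sign_in T j * a j)"
      by (simp add: exp_sum sign_in_def)
    moreover have "(\<Sum>j<p. sign_in T j * a j) = (\<Sum>j\<in>{..<p} - T. sign_in T j * a j) + (\<Sum>j\<in>T. sign_in T j * a j)"
      using T by (intro sum.subset_diff) auto
    ultimately show "(\<Prod>j\<in>T. exp (a j)) * (\<Prod>j\<in>{..<p} - T. exp (- a j)) = exp (\<Sum>j<p. sign_in T j * a j)"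
      by (simp add: exp_add[symmetric] add.commute)
  qed
  finally show ?thesis ..
qed

text \<open>Complementing \<open>T\<close> negates every sign.\<close>

lemma sum_signs_flip:
  fixes F :: "real \<Rightarrow> real"
  shows "(\<Sum>T\<in>Pow {..<p}. F (\<Sum>j<p. sign_in T j * a j)) = (\<Sum>T\<in>Pow {..<p}. F (- (\<Sum>j<p. sign_in T j * a j)))"
proof (rule sum.reindex_bij_witness[where i = "\<lambda>T. {..<p} - T" and j = "\<lambda>T. {..<p} - T"])
  fix T assume T: "T \<in> Pow {..<p}"
  have "(\<Sum>j<p. sign_in ({..<p} - T) j * a j) = (\<Sum>j<p. - (sign_in T j * a j))"
    by (intro sum.cong) (auto simp: sign_in_def)
  then show "F (- (\<Sum>j<p. sign_in ({..<p} - T) j * a j)) = F (\<Sum>j<p. sign_in T j * a j)"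
    by (simp add: sum_negf)
qed auto

lemma card_subsets_containing:
  assumes "B \<subseteq> {..<p}" "card B = b" "b \<le> k"
  shows "card {m. m \<subseteq> {..<p} \<and> card m = k \<and> B \<subseteq> m} = (p - b) choose (k - b)"
proof -
  have finB: "finite B" using assms(1) finite_subset by blast
  have "bij_betw (\<lambda>m. m - B) {m. m \<subseteq> {..<p} \<and> card m = k \<and> B \<subseteq> m}
      {m. m \<subseteq> {..<p} - B \<and> card m = k - b}"
  proof (rule bij_betwI[where g = "\<lambda>m. m \<union> B"])
    show "(\<lambda>m. m - B) \<in> {m. m \<subseteq> {..<p} \<and> card m = k \<and> B \<subseteq> m} \<rightarrow> {m. m \<subseteq> {..<p} - B \<and> card m = k - b}"
      using finB assms by (auto simp: card_Diff_subset)
    show "(\<lambda>m. m \<union> B) \<in> {m. m \<subseteq> {..<p} - B \<and> card m = k - b} \<rightarrow> {m. m \<subseteq> {..<p} \<and> card m = k \<and> B \<subseteq> m}"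
    proof (rule Pi_I)
      fix m assume m: "m \<in> {m. m \<subseteq> {..<p} - B \<and> card m = k - b}"
      then have "finite m" by (auto intro: finite_subset)
      then have "card (m \<union> B) = card m + card B" using m finB by (intro card_Un_disjoint) auto
      then show "m \<union> B \<in> {m. m \<subseteq> {..<p} \<and> card m = k \<and> B \<subseteq> m}" using m assms by auto
    qed
  qed auto
  then have "card {m. m \<subseteq> {..<p} \<and> card m = k \<and> B \<subseteq> m} = card {m. m \<subseteq> {..<p} - B \<and> card m = k - b}"
    by (rule bij_betw_same_card)
  also have "\<dots> = card ({..<p} - B) choose (k - b)"
    by (rule n_subsets) simp
  also have "card ({..<p} - B) = p - b" using assms finB by (simp add: card_Diff_subset)
  finally show ?thesis .
qed

text \<open>The quotient of the binomials is the product of the fractions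
  \<open>(k - i) / (p - i)\<close> over \<open>i < b\<close>, each at most \<open>k / p\<close>.
  Together with \<open>card_subsets_containing\<close> it bounds the probability that a random
  \<open>k\<close>-subset contains \<open>b\<close> given points.\<close>

lemma binomial_diff_ratio_le:
  assumes "b \<le> k" "k \<le> p"
  shows "real ((p - b) choose (k - b)) \<le> real (p choose k) * (real k / real p) ^ b"
  using assms(1)
proof (induction b)
  case 0
  then show ?case by simp
next
  case (Suc b)
  define P where "P = p - Suc b"
  define K where "K = k - Suc b"
  have e: "p - b = Suc P" "k - b = Suc K" using Suc.prems assms(2) by (auto simp: P_def K_def)
  have "Suc K * (Suc P choose Suc K) = Suc P * (P choose K)"
    by (rule Suc_times_binomial)
  then have "real (Suc K) * real (Suc P choose Suc K) = real (Suc P) * real (P choose K)"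
    unfolding of_nat_mult[symmetric] by (simp only:)
  then have "real (P choose K) = real (Suc P choose Suc K) * (real (Suc K) / real (Suc P))"
    by (simp add: field_simps)
  also have "\<dots> \<le> real (Suc P choose Suc K) * (real k / real p)"
  proof (rule mult_left_mono)
    have "real (Suc K) = real k - real b" "real (Suc P) = real p - real b"
      using e Suc.prems assms(2) by (auto simp: P_def K_def of_nat_diff)
    moreover have "real b < real p" using Suc.prems assms(2) by simp
    moreover have "real b * real k \<le> real b * real p" using assms(2) by (intro mult_left_mono) auto
    ultimately show "real (Suc K) / real (Suc P) \<le> real k / real p"
      by (simp add: divide_simps) (simp add: algebra_simps)
  qed simp
  also have "\<dots> \<le> (real (p choose k) * (real k / real p) ^ b) * (real k / real p)"
    using Suc e by (intro mult_right_mono) auto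
  finally show ?case by (simp add: P_def K_def mult_ac)
qed

text \<open>The overlap of two supports is hypergeometric, and its generating function is dominated
  by the binomial one. Expanding the power over subsets \<open>B\<close> of the overlap and
  exchanging sums leaves containment counts, each with a factor at most
  \<open>(k / p) ^ card B\<close>; these resum to \<open>(1 + w * k / p) ^ k\<close>.\<close>

lemma sum_power_card_inter_le:
  fixes w :: real
  assumes m: "m \<subseteq> {..<p}" "card m = k" and "1 \<le> k" "k \<le> p" and w: "0 \<le> w"
  shows "(\<Sum>m'\<in>{m'. m' \<subseteq> {..<p} \<and> card m' = k}. (1 + w) ^ card (m \<inter> m'))
    \<le> real (p choose k) * exp (w * (real k)\<^sup>2 / real p)"
proof -
  let ?S = "{m'. m' \<subseteq> {..<p} \<and> card m' = k}"
  have finS: "finite ?S" by simp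
  have finm: "finite m" using m finite_subset by blast
  have expand: "(1 + w) ^ card (m \<inter> m') = (\<Sum>B\<in>Pow m. if B \<subseteq> m' then w ^ card B else 0)" for m'
  proof -
    have "(1 + w) ^ card (m \<inter> m') = (\<Prod>j\<in>m \<inter> m'. w + 1)" by (simp add: add.commute)
    also have "\<dots> = (\<Sum>B\<in>Pow (m \<inter> m'). w ^ card B)"
      using finm by (subst prod_add) auto
    also have "\<dots> = (\<Sum>B\<in>Pow m. if B \<subseteq> m' then w ^ card B else 0)"
      using finm by (intro sum.mono_neutral_cong_left) auto
    finally show ?thesis .
  qed
  have "(\<Sum>m'\<in>?S. (1 + w) ^ card (m \<inter> m')) = (\<Sum>B\<in>Pow m. \<Sum>m'\<in>?S. if B \<subseteq> m' then w ^ card B else 0)"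
    unfolding expand by (rule sum.swap)
  also have "\<dots> \<le> (\<Sum>B\<in>Pow m. real (p choose k) * (w * (real k / real p)) ^ card B)"
  proof (rule sum_mono)
    fix B assume "B \<in> Pow m"
    then have B: "B \<subseteq> m" "B \<subseteq> {..<p}" "card B \<le> k" using m finm by (auto intro: card_mono)
    have "(\<Sum>m'\<in>?S. if B \<subseteq> m' then w ^ card B else 0) = (\<Sum>m'\<in>{m'. m' \<subseteq> {..<p} \<and> card m' = k \<and> B \<subseteq> m'}. w ^ card B)"
      using finS by (intro sum.mono_neutral_cong_right) auto
    also have "\<dots> = w ^ card B * real ((p - card B) choose (k - card B))"
      using card_subsets_containing[OF B(2) refl B(3)] by simp
    also have "\<dots> \<le> w ^ card B * (real (p choose k) * (real k / real p) ^ card B)"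
      using w B assms(4) by (intro mult_left_mono binomial_diff_ratio_le) auto
    finally show "(\<Sum>m'\<in>?S. if B \<subseteq> m' then w ^ card B else 0) \<le> real (p choose k) * (w * (real k / real p)) ^ card B"
      by (simp only: power_mult_distrib mult_ac)
  qed
  also have "\<dots> = real (p choose k) * (1 + w * (real k / real p)) ^ k"
  proof -
    have "(\<Prod>j\<in>m. w * (real k / real p) + 1) = (\<Sum>B\<in>Pow m. (w * (real k / real p)) ^ card B)"
      using finm by (subst prod_add) auto
    then show ?thesis using m by (simp add: sum_distrib_left[symmetric] add.commute)
  qed
  also have "\<dots> \<le> real (p choose k) * exp (w * (real k)\<^sup>2 / real p)"
  proof (rule mult_left_mono)
    have "(1 + w * (real k / real p)) ^ k \<le> exp (w * (real k / real p)) ^ k"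
      using w by (intro power_mono exp_ge_add_one_self) auto
    also have "\<dots> = exp (w * (real k)\<^sup>2 / real p)"
      by (simp add: exp_of_nat_mult[symmetric] power2_eq_square mult_ac)
    finally show "(1 + w * (real k / real p)) ^ k \<le> exp (w * (real k)\<^sup>2 / real p)" .
  qed simp
  finally show ?thesis .
qed

subsection \<open>Linear images of independent standard normals\<close>

definition std_normal :: "real measure" where
  "std_normal = density lborel (\<lambda>x. ennreal (std_normal_density x))"

lemma prob_space_std_normal: "prob_space std_normal"
  unfolding std_normal_def using prob_space_normal_density[of 1 0] by simp

lemma sets_std_normal [simp, measurable_cong]: "sets std_normal = sets borel"
  by (simp add: std_normal_def)

lemma nn_integral_std_normal:
  assumes [measurable]: "f \<in> borel_measurable borel"
  shows "(\<integral>\<^sup>+x. f x \<partial>std_normal) = (\<integral>\<^sup>+x. ennreal (std_normal_density x) * f x \<partial>lborel)"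
  unfolding std_normal_def by (subst nn_integral_density) auto

lemma measurable_normal_density_mean [measurable]:
  assumes [measurable]: "f \<in> borel_measurable M" "g \<in> borel_measurable M"
  shows "(\<lambda>x. normal_density (f x) \<sigma> (g x)) \<in> borel_measurable M"
  unfolding normal_density_def by measurable

lemma std_normal_swap:
  assumes [measurable]: "case_prod F \<in> borel_measurable (borel \<Otimes>\<^sub>M borel)"
  shows "(\<integral>\<^sup>+x. \<integral>\<^sup>+y. F x y \<partial>std_normal \<partial>std_normal) = (\<integral>\<^sup>+y. \<integral>\<^sup>+x. F x y \<partial>std_normal \<partial>std_normal)"
proof -
  interpret N: prob_space std_normal by (rule prob_space_std_normal)
  interpret pair_sigma_finite std_normal std_normal ..
  show ?thesis by (rule Fubini'[symmetric]) measurable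
qed

lemma std_normal_density_rotate:
  assumes "c\<^sup>2 + s\<^sup>2 = 1"
  shows "std_normal_density (c * x - s * y) * std_normal_density (s * x + c * y)
    = std_normal_density x * std_normal_density y"
proof -
  have "(c * x - s * y)\<^sup>2 + (s * x + c * y)\<^sup>2 = (c\<^sup>2 + s\<^sup>2) * (x\<^sup>2 + y\<^sup>2)"
    by (simp add: power2_eq_square algebra_simps)
  then have *: "(c * x - s * y)\<^sup>2 + (s * x + c * y)\<^sup>2 = x\<^sup>2 + y\<^sup>2" using assms by simp
  have "exp (- (c * x - s * y)\<^sup>2 / 2) * exp (- (s * x + c * y)\<^sup>2 / 2) = exp (- ((c * x - s * y)\<^sup>2 + (s * x + c * y)\<^sup>2) / 2)"
    by (simp only: exp_add[symmetric]) (simp add: add_divide_distrib)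
  also have "\<dots> = exp (- x\<^sup>2 / 2) * exp (- y\<^sup>2 / 2)"
    unfolding * by (simp only: exp_add[symmetric]) (simp add: add_divide_distrib)
  finally show ?thesis by (simp add: std_normal_density_def)
qed

text \<open>The rotation is split into two one-dimensional affine substitutions: first the new first
  coordinate replaces \<open>x\<close> with \<open>y\<close> fixed, then the new second coordinate
  replaces \<open>y\<close>. The scale factors \<open>1/c\<close> and \<open>c\<close> cancel, and
  the product density is rotation invariant.\<close>

lemma std_normal_rotate_nonzero:
  fixes F :: "real \<Rightarrow> real \<Rightarrow> ennreal"
  assumes [measurable]: "case_prod F \<in> borel_measurable (borel \<Otimes>\<^sub>M borel)"
    and cs: "c\<^sup>2 + s\<^sup>2 = 1" and c: "c \<noteq> 0"
  shows "(\<integral>\<^sup>+x. \<integral>\<^sup>+y. F (c * x - s * y) (s * x + c * y) \<partial>std_normal \<partial>std_normal)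
    = (\<integral>\<^sup>+x. \<integral>\<^sup>+y. F x y \<partial>std_normal \<partial>std_normal)"
proof -
  let ?\<phi> = "\<lambda>x. ennreal (std_normal_density x)"
  have "(\<integral>\<^sup>+x. \<integral>\<^sup>+y. F (c * x - s * y) (s * x + c * y) \<partial>std_normal \<partial>std_normal)
      = (\<integral>\<^sup>+y. \<integral>\<^sup>+x. F (c * x - s * y) (s * x + c * y) \<partial>std_normal \<partial>std_normal)"
    by (rule std_normal_swap) measurable
  also have "\<dots> = (\<integral>\<^sup>+y. \<integral>\<^sup>+x. ?\<phi> y * (?\<phi> x * F (c * x - s * y) (s * x + c * y)) \<partial>lborel \<partial>lborel)"
    by (simp add: nn_integral_std_normal nn_integral_cmult)
  also have "\<dots> = (\<integral>\<^sup>+y. \<bar>1/c\<bar> * (\<integral>\<^sup>+x. ?\<phi> y * (?\<phi> ((s * y + x) / c) * F x ((s * x + y) / c)) \<partial>lborel) \<partial>lborel)"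
  proof (rule nn_integral_cong)
    fix y :: real
    have 1: "s * y / c + 1 / c * x = (s * y + x) / c" for x by (simp add: add_divide_distrib)
    have 2: "c * ((s * y + x) / c) - s * y = x" for x using c by simp
    have 3: "s * ((s * y + x) / c) + c * y = (s * x + y) / c" for x
    proof -
      have "s * ((s * y + x) / c) + c * y = (s * x + (c\<^sup>2 + s\<^sup>2) * y) / c"
        using c by (simp add: field_simps power2_eq_square)
      then show ?thesis by (simp add: cs)
    qed
    have "(\<integral>\<^sup>+x. ?\<phi> y * (?\<phi> x * F (c * x - s * y) (s * x + c * y)) \<partial>lborel)
       = \<bar>1/c\<bar> * (\<integral>\<^sup>+x. ?\<phi> y * (?\<phi> (s * y / c + 1 / c * x) * F (c * (s * y / c + 1 / c * x) - s * y) (s * (s * y / c + 1 / c * x) + c * y)) \<partial>lborel)"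
      by (rule nn_integral_real_affine) (use c in auto)
    then show "(\<integral>\<^sup>+x. ?\<phi> y * (?\<phi> x * F (c * x - s * y) (s * x + c * y)) \<partial>lborel)
       = \<bar>1/c\<bar> * (\<integral>\<^sup>+x. ?\<phi> y * (?\<phi> ((s * y + x) / c) * F x ((s * x + y) / c)) \<partial>lborel)"
      unfolding 1 2 3 .
  qed
  also have "\<dots> = (\<integral>\<^sup>+y. \<integral>\<^sup>+x. \<bar>1/c\<bar> * (?\<phi> y * (?\<phi> ((s * y + x) / c) * F x ((s * x + y) / c))) \<partial>lborel \<partial>lborel)"
    by (simp add: nn_integral_cmult)
  also have "\<dots> = (\<integral>\<^sup>+x. \<integral>\<^sup>+y. \<bar>1/c\<bar> * (?\<phi> y * (?\<phi> ((s * y + x) / c) * F x ((s * x + y) / c))) \<partial>lborel \<partial>lborel)"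
    by (rule lborel_pair.Fubini') measurable
  also have "\<dots> = (\<integral>\<^sup>+x. \<integral>\<^sup>+y. ?\<phi> x * (?\<phi> y * F x y) \<partial>lborel \<partial>lborel)"
  proof (rule nn_integral_cong)
    fix x :: real
    have 1: "- s * x + c * y = c * y - s * x" for y by simp
    have 2: "(s * x + (c * y - s * x)) / c = y" for y using c by simp
    have 3: "(s * (c * y - s * x) + x) / c = s * y + c * x" for y
    proof -
      have "s * (c * y - s * x) + x = s * (c * y - s * x) + (c\<^sup>2 + s\<^sup>2) * x" by (simp add: cs)
      also have "\<dots> = (s * y + c * x) * c" by (simp add: power2_eq_square algebra_simps)
      finally show ?thesis using c by simp
    qed
    have 4: "ennreal \<bar>c\<bar> * (ennreal \<bar>1 / c\<bar> * (?\<phi> (c * y - s * x) * (?\<phi> (s * y + c * x) * F x y)))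
       = ?\<phi> x * (?\<phi> y * F x y)" for y
    proof -
      have "ennreal \<bar>c\<bar> * (ennreal \<bar>1 / c\<bar> * (?\<phi> (c * y - s * x) * (?\<phi> (s * y + c * x) * F x y)))
         = (ennreal \<bar>c\<bar> * ennreal \<bar>1 / c\<bar>) * ((?\<phi> (c * y - s * x) * ?\<phi> (s * y + c * x)) * F x y)"
        by (simp only: mult.assoc)
      also have "ennreal \<bar>c\<bar> * ennreal \<bar>1 / c\<bar> = 1"
        using c by (simp add: ennreal_mult[symmetric] abs_mult[symmetric])
      also have "?\<phi> (c * y - s * x) * ?\<phi> (s * y + c * x) = ?\<phi> y * ?\<phi> x"
        by (simp add: ennreal_mult[symmetric] std_normal_density_rotate[OF cs])
      finally show ?thesis by (simp add: mult_ac)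
    qed
    have "(\<integral>\<^sup>+y. \<bar>1/c\<bar> * (?\<phi> y * (?\<phi> ((s * y + x) / c) * F x ((s * x + y) / c))) \<partial>lborel)
      = \<bar>c\<bar> * (\<integral>\<^sup>+y. \<bar>1/c\<bar> * (?\<phi> (- s * x + c * y) * (?\<phi> ((s * (- s * x + c * y) + x) / c) * F x ((s * x + (- s * x + c * y)) / c))) \<partial>lborel)"
      by (rule nn_integral_real_affine) (use c in auto)
    also have "\<dots> = \<bar>c\<bar> * (\<integral>\<^sup>+y. \<bar>1/c\<bar> * (?\<phi> (c * y - s * x) * (?\<phi> (s * y + c * x) * F x y)) \<partial>lborel)"
      unfolding 1 2 3 ..
    also have "\<dots> = (\<integral>\<^sup>+y. ?\<phi> x * (?\<phi> y * F x y) \<partial>lborel)"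
      by (subst nn_integral_cmult[symmetric], measurable) (simp only: 4)
    finally show "(\<integral>\<^sup>+y. \<bar>1/c\<bar> * (?\<phi> y * (?\<phi> ((s * y + x) / c) * F x ((s * x + y) / c))) \<partial>lborel)
      = (\<integral>\<^sup>+y. ?\<phi> x * (?\<phi> y * F x y) \<partial>lborel)" .
  qed
  also have "\<dots> = (\<integral>\<^sup>+x. \<integral>\<^sup>+y. F x y \<partial>std_normal \<partial>std_normal)"
    by (simp add: nn_integral_std_normal nn_integral_cmult)
  finally show ?thesis .
qed

lemma std_normal_reflect:
  assumes [measurable]: "f \<in> borel_measurable borel"
  shows "(\<integral>\<^sup>+x. f (- x) \<partial>std_normal) = (\<integral>\<^sup>+x. f x \<partial>std_normal)"
proof -
  have "(\<integral>\<^sup>+x. ennreal (std_normal_density x) * f x \<partial>lborel) = (\<integral>\<^sup>+x. ennreal (std_normal_density (-x)) * f (-x) \<partial>lborel)"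
    by (subst nn_integral_real_affine[where c = "-1" and t = 0]) auto
  then show ?thesis by (simp add: nn_integral_std_normal std_normal_density_def)
qed

text \<open>What remains is \<open>c = 0\<close>, a quarter turn, which is a coordinate swap
  combined with a reflection.\<close>

lemma std_normal_rotate:
  fixes F :: "real \<Rightarrow> real \<Rightarrow> ennreal"
  assumes [measurable]: "case_prod F \<in> borel_measurable (borel \<Otimes>\<^sub>M borel)"
    and cs: "c\<^sup>2 + s\<^sup>2 = 1"
  shows "(\<integral>\<^sup>+x. \<integral>\<^sup>+y. F (c * x - s * y) (s * x + c * y) \<partial>std_normal \<partial>std_normal)
    = (\<integral>\<^sup>+x. \<integral>\<^sup>+y. F x y \<partial>std_normal \<partial>std_normal)"
proof (cases "c = 0")
  case False
  then show ?thesis using std_normal_rotate_nonzero[OF assms] by simp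
next
  case True
  then have "s = 1 \<or> s = -1" using cs by (simp add: power2_eq_1_iff)
  then show ?thesis
  proof
    assume s: "s = 1"
    have "(\<integral>\<^sup>+x. \<integral>\<^sup>+y. F (- y) x \<partial>std_normal \<partial>std_normal) = (\<integral>\<^sup>+x. \<integral>\<^sup>+y. F y x \<partial>std_normal \<partial>std_normal)"
      by (intro nn_integral_cong std_normal_reflect[where f = "\<lambda>y. F y _"]) measurable
    also have "\<dots> = (\<integral>\<^sup>+x. \<integral>\<^sup>+y. F x y \<partial>std_normal \<partial>std_normal)"
      by (rule std_normal_swap) measurable
    finally show ?thesis using True s by simp
  next
    assume s: "s = -1"
    have "(\<integral>\<^sup>+x. \<integral>\<^sup>+y. F y (- x) \<partial>std_normal \<partial>std_normal) = (\<integral>\<^sup>+y. \<integral>\<^sup>+x. F y (- x) \<partial>std_normal \<partial>std_normal)"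
      by (rule std_normal_swap) measurable
    also have "\<dots> = (\<integral>\<^sup>+x. \<integral>\<^sup>+y. F x y \<partial>std_normal \<partial>std_normal)"
      by (intro nn_integral_cong std_normal_reflect[where f = "\<lambda>x. F _ x"]) measurable
    finally show ?thesis using True s by simp
  qed
qed

lemma unit_vector_obtain:
  fixes a u :: real
  obtains C S where "C\<^sup>2 + S\<^sup>2 = 1" "a = sqrt (a\<^sup>2 + u\<^sup>2) * C" "u = sqrt (a\<^sup>2 + u\<^sup>2) * S"
proof (cases "a\<^sup>2 + u\<^sup>2 = 0")
  case True
  then have "a = 0" "u = 0" by (auto simp: sum_power2_eq_zero_iff)
  then show ?thesis using that[of 1 0] by simp
next
  case False
  define d where "d = sqrt (a\<^sup>2 + u\<^sup>2)"
  have d: "d > 0" "d\<^sup>2 = a\<^sup>2 + u\<^sup>2" using False by (auto simp: d_def sum_power2_gt_zero_iff sum_power2_eq_zero_iff)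
  have "(a/d)\<^sup>2 + (u/d)\<^sup>2 = 1" 
    using d(1) unfolding power_divide add_divide_distrib[symmetric] d(2)[symmetric] by simp
  then show ?thesis using that[of "a/d" "u/d"] d(1) unfolding d_def[symmetric] by simp
qed

text \<open>Rotating the plane so that \<open>(e, c)\<close> points along the first axis makes the
  integrand depend on one variable only; the other integrates to one.\<close>

lemma std_normal_linear_combination:
  fixes f :: "real \<Rightarrow> ennreal"
  assumes [measurable]: "f \<in> borel_measurable borel"
  shows "(\<integral>\<^sup>+y. \<integral>\<^sup>+h. f (e * y + c * h) \<partial>std_normal \<partial>std_normal) = (\<integral>\<^sup>+h. f (sqrt (e\<^sup>2 + c\<^sup>2) * h) \<partial>std_normal)"
proof -
  interpret N: prob_space std_normal by (rule prob_space_std_normal)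
  define d where "d = sqrt (e\<^sup>2 + c\<^sup>2)"
  obtain C S where CS: "C\<^sup>2 + S\<^sup>2 = 1" "e = d * C" "c = d * S"
    using unit_vector_obtain[of e c] unfolding d_def by blast
  have "(\<integral>\<^sup>+y. \<integral>\<^sup>+h. f (e * y + c * h) \<partial>std_normal \<partial>std_normal)
     = (\<integral>\<^sup>+y. \<integral>\<^sup>+h. f (e * (C * y - S * h) + c * (S * y + C * h)) \<partial>std_normal \<partial>std_normal)"
    by (rule std_normal_rotate[OF _ CS(1), symmetric, of "\<lambda>y h. f (e * y + c * h)"]) measurable
  also have "\<dots> = (\<integral>\<^sup>+y. \<integral>\<^sup>+h. f (d * y) \<partial>std_normal \<partial>std_normal)"
  proof -
    have "e * (C * y - S * h) + c * (S * y + C * h) = d * y" for y h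
    proof -
      have "e * (C * y - S * h) + c * (S * y + C * h) = d * ((C\<^sup>2 + S\<^sup>2) * y)"
        by (simp add: CS(2,3) power2_eq_square algebra_simps)
      then show ?thesis by (simp add: CS(1))
    qed
    then show ?thesis by simp
  qed
  also have "\<dots> = (\<integral>\<^sup>+y. f (d * y) \<partial>std_normal)"
    using N.emeasure_space_1 by simp
  finally show ?thesis by (simp add: d_def)
qed

text \<open>The numbers \<open>a\<close>, \<open>b\<close>, \<open>c\<close> form a triangular
  (Cholesky) factor of the Gram matrix of \<open>u\<close> and \<open>w\<close>, reached by adding
  one coordinate at a time. Quantifying over all \<open>F\<close> inside the claim lets the
  induction hypothesis be used for \<open>F\<close> shifted by the contribution of the new
  coordinate.\<close>

lemma std_normal_pair_law:
  fixes u w :: "'i \<Rightarrow> real"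
  assumes "finite J"
  shows "\<exists>a b c. a\<^sup>2 = (\<Sum>j\<in>J. (u j)\<^sup>2) \<and> a * b = (\<Sum>j\<in>J. u j * w j) \<and> b\<^sup>2 + c\<^sup>2 = (\<Sum>j\<in>J. (w j)\<^sup>2) \<and>
    (\<forall>F :: real \<Rightarrow> real \<Rightarrow> ennreal. case_prod F \<in> borel_measurable (borel \<Otimes>\<^sub>M borel) \<longrightarrow>
      (\<integral>\<^sup>+x. ennreal (\<Prod>j\<in>J. std_normal_density (x j)) * F (\<Sum>j\<in>J. u j * x j) (\<Sum>j\<in>J. w j * x j) \<partial>PiM J (\<lambda>_. lborel))
      = (\<integral>\<^sup>+g. \<integral>\<^sup>+h. F (a * g) (b * g + c * h) \<partial>std_normal \<partial>std_normal))"
  using assms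
proof (induction J rule: finite_induct)
  case empty
  interpret N: prob_space std_normal by (rule prob_space_std_normal)
  have "(\<integral>\<^sup>+x. ennreal (\<Prod>j\<in>{}. std_normal_density (x j)) * F (\<Sum>j\<in>{}. u j * x j) (\<Sum>j\<in>{}. w j * x j) \<partial>PiM {} (\<lambda>_. lborel))
      = (\<integral>\<^sup>+g. \<integral>\<^sup>+h. F (0 * g) (0 * g + 0 * h) \<partial>std_normal \<partial>std_normal)"
    for F :: "real \<Rightarrow> real \<Rightarrow> ennreal"
    using N.emeasure_space_1 by (simp add: PiM_empty)
  then show ?case
    by (intro exI[of _ 0] conjI allI impI) simp_all
next
  case (insert i J)
  interpret product_sigma_finite "\<lambda>_::'i. lborel :: real measure" ..
  interpret N: prob_space std_normal by (rule prob_space_std_normal)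
  from insert.IH obtain a b c where abc: "a\<^sup>2 = (\<Sum>j\<in>J. (u j)\<^sup>2)" "a * b = (\<Sum>j\<in>J. u j * w j)" "b\<^sup>2 + c\<^sup>2 = (\<Sum>j\<in>J. (w j)\<^sup>2)"
    and IH: "\<forall>F :: real \<Rightarrow> real \<Rightarrow> ennreal. case_prod F \<in> borel_measurable (borel \<Otimes>\<^sub>M borel) \<longrightarrow>
      (\<integral>\<^sup>+x. ennreal (\<Prod>j\<in>J. std_normal_density (x j)) * F (\<Sum>j\<in>J. u j * x j) (\<Sum>j\<in>J. w j * x j) \<partial>PiM J (\<lambda>_. lborel))
      = (\<integral>\<^sup>+g. \<integral>\<^sup>+h. F (a * g) (b * g + c * h) \<partial>std_normal \<partial>std_normal)"
    by (elim exE conjE) (rule that)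
  define a' where "a' = sqrt (a\<^sup>2 + (u i)\<^sup>2)"
  obtain C S where CS: "C\<^sup>2 + S\<^sup>2 = 1" "a = a' * C" "u i = a' * S"
    using unit_vector_obtain[of a "u i"] unfolding a'_def by blast
  \<comment> \<open>\<open>b'\<close> and \<open>e\<close> are the coefficients of the second linear
    form in the rotated pair \<open>(g, y)\<close>.\<close>
  define b' where "b' = w i * S + b * C"
  define e where "e = w i * C - b * S"
  define c' where "c' = sqrt (e\<^sup>2 + c\<^sup>2)"
  have g1: "a'\<^sup>2 = (\<Sum>j\<in>insert i J. (u j)\<^sup>2)" 
  proof -
    have "a'\<^sup>2 = a\<^sup>2 + (u i)\<^sup>2" by (simp add: a'_def)
    then show ?thesis using insert.hyps by (simp add: abc(1))
  qed
  have g2: "a' * b' = (\<Sum>j\<in>insert i J. u j * w j)"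
    using insert.hyps by (simp add: abc(2)[symmetric] b'_def CS(2,3) algebra_simps)
  have g3: "b'\<^sup>2 + c'\<^sup>2 = (\<Sum>j\<in>insert i J. (w j)\<^sup>2)"
  proof -
    have "b'\<^sup>2 + e\<^sup>2 = (C\<^sup>2 + S\<^sup>2) * ((w i)\<^sup>2 + b\<^sup>2)"
      by (simp add: b'_def e_def power2_eq_square algebra_simps)
    then have "b'\<^sup>2 + c'\<^sup>2 = (w i)\<^sup>2 + (b\<^sup>2 + c\<^sup>2)" by (simp add: CS(1) c'_def)
    then show ?thesis using insert.hyps by (simp add: abc(3))
  qed
  have law: "(\<integral>\<^sup>+x. ennreal (\<Prod>j\<in>insert i J. std_normal_density (x j)) * F (\<Sum>j\<in>insert i J. u j * x j) (\<Sum>j\<in>insert i J. w j * x j) \<partial>PiM (insert i J) (\<lambda>_. lborel))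
      = (\<integral>\<^sup>+g. \<integral>\<^sup>+h. F (a' * g) (b' * g + c' * h) \<partial>std_normal \<partial>std_normal)"
    if F[measurable]: "case_prod F \<in> borel_measurable (borel \<Otimes>\<^sub>M borel)" for F :: "real \<Rightarrow> real \<Rightarrow> ennreal"
  proof -
    have upd: "(\<Prod>j\<in>J. std_normal_density ((x(i := y)) j)) = (\<Prod>j\<in>J. std_normal_density (x j))"
      "(\<Sum>j\<in>J. v j * (x(i := y)) j) = (\<Sum>j\<in>J. v j * x j)" for x :: "'i \<Rightarrow> real" and y and v :: "'i \<Rightarrow> real"
      using insert.hyps by (auto intro!: prod.cong sum.cong)
    have "(\<integral>\<^sup>+x. ennreal (\<Prod>j\<in>insert i J. std_normal_density (x j)) * F (\<Sum>j\<in>insert i J. u j * x j) (\<Sum>j\<in>insert i J. w j * x j) \<partial>PiM (insert i J) (\<lambda>_. lborel))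
      = (\<integral>\<^sup>+y. \<integral>\<^sup>+x. ennreal (\<Prod>j\<in>insert i J. std_normal_density ((x(i := y)) j)) * F (\<Sum>j\<in>insert i J. u j * (x(i := y)) j) (\<Sum>j\<in>insert i J. w j * (x(i := y)) j) \<partial>PiM J (\<lambda>_. lborel) \<partial>lborel)"
      using insert.hyps by (intro product_nn_integral_insert_rev) auto
    also have "\<dots> = (\<integral>\<^sup>+y. ennreal (std_normal_density y) * (\<integral>\<^sup>+x. ennreal (\<Prod>j\<in>J. std_normal_density (x j)) * F (u i * y + (\<Sum>j\<in>J. u j * x j)) (w i * y + (\<Sum>j\<in>J. w j * x j)) \<partial>PiM J (\<lambda>_. lborel)) \<partial>lborel)"
      unfolding sum.insert[OF insert.hyps] prod.insert[OF insert.hyps] upd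
      by (simp add: ennreal_mult prod_nonneg mult.assoc nn_integral_cmult)
    also have "\<dots> = (\<integral>\<^sup>+y. ennreal (std_normal_density y) * (\<integral>\<^sup>+g. \<integral>\<^sup>+h. F (u i * y + a * g) (w i * y + (b * g + c * h)) \<partial>std_normal \<partial>std_normal) \<partial>lborel)"
    proof (intro nn_integral_cong arg_cong2[where f = "(*)"] refl)
      fix y
      show "(\<integral>\<^sup>+x. ennreal (\<Prod>j\<in>J. std_normal_density (x j)) * F (u i * y + (\<Sum>j\<in>J. u j * x j)) (w i * y + (\<Sum>j\<in>J. w j * x j)) \<partial>PiM J (\<lambda>_. lborel))
         = (\<integral>\<^sup>+g. \<integral>\<^sup>+h. F (u i * y + a * g) (w i * y + (b * g + c * h)) \<partial>std_normal \<partial>std_normal)"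
        by (rule IH[rule_format, of "\<lambda>A B. F (u i * y + A) (w i * y + B)"]) measurable
    qed
    also have "\<dots> = (\<integral>\<^sup>+y. \<integral>\<^sup>+g. \<integral>\<^sup>+h. F (u i * y + a * g) (w i * y + (b * g + c * h)) \<partial>std_normal \<partial>std_normal \<partial>std_normal)"
      by (rule nn_integral_std_normal[symmetric]) measurable
    also have "\<dots> = (\<integral>\<^sup>+g. \<integral>\<^sup>+y. \<integral>\<^sup>+h. F (u i * y + a * g) (w i * y + (b * g + c * h)) \<partial>std_normal \<partial>std_normal \<partial>std_normal)"
      by (rule std_normal_swap) measurable
    \<comment> \<open>This rotation aligns \<open>(a, u i)\<close> with the first axis, so the first
      form becomes \<open>a' * g\<close> and \<open>y\<close> survives only in the second.\<close>
    also have "\<dots> = (\<integral>\<^sup>+g. \<integral>\<^sup>+y. \<integral>\<^sup>+h. F (u i * (S * g + C * y) + a * (C * g - S * y)) (w i * (S * g + C * y) + (b * (C * g - S * y) + c * h)) \<partial>std_normal \<partial>std_normal \<partial>std_normal)"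
      by (rule std_normal_rotate[OF _ CS(1), symmetric,
            of "\<lambda>g y. \<integral>\<^sup>+h. F (u i * y + a * g) (w i * y + (b * g + c * h)) \<partial>std_normal"]) measurable
    also have "\<dots> = (\<integral>\<^sup>+g. \<integral>\<^sup>+y. \<integral>\<^sup>+h. F (a' * g) (b' * g + (e * y + c * h)) \<partial>std_normal \<partial>std_normal \<partial>std_normal)"
    proof -
      have "u i * (S * g + C * y) + a * (C * g - S * y) = a' * g" for g y
      proof -
        have "u i * (S * g + C * y) + a * (C * g - S * y) = a' * ((C\<^sup>2 + S\<^sup>2) * g)"
          by (simp add: CS(2,3) power2_eq_square algebra_simps)
        then show ?thesis by (simp add: CS(1))
      qed
      moreover have "w i * (S * g + C * y) + (b * (C * g - S * y) + c * h) = b' * g + (e * y + c * h)" for g y h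
        by (simp add: b'_def e_def algebra_simps)
      ultimately show ?thesis by (simp only:)
    qed
    \<comment> \<open>The leftover \<open>e * y + c * h\<close> is a single centered normal of
      variance \<open>e\<^sup>2 + c\<^sup>2\<close>, which restores the two-variable form.\<close>
    also have "\<dots> = (\<integral>\<^sup>+g. \<integral>\<^sup>+h. F (a' * g) (b' * g + c' * h) \<partial>std_normal \<partial>std_normal)"
      unfolding c'_def
      by (intro nn_integral_cong std_normal_linear_combination[where f = "\<lambda>z. F _ (_ + z)"]) measurable
    finally show ?thesis .
  qed
  show ?case
    by (rule exI[of _ a'], rule exI[of _ b'], rule exI[of _ c']) (intro conjI allI impI g1 g2 g3 law)
qed

section \<open>Gaussian integrals for a single observation\<close>

text \<open>Randomizing the mean by an independent \<open>N(0, c\<^sup>2)\<close> convolves two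
  centered normals, so variances add. The convolution formula needs positive scales, hence the
  separate case \<open>c = 0\<close>.\<close>

lemma std_normal_mixture:
  assumes s: "0 < s"
  shows "(\<integral>\<^sup>+h. ennreal (normal_density (m + c * h) s y) \<partial>std_normal) = ennreal (normal_density m (sqrt (s\<^sup>2 + c\<^sup>2)) y)"
proof (cases "c = 0")
  case True
  interpret N: prob_space std_normal by (rule prob_space_std_normal)
  show ?thesis using True s N.emeasure_space_1 by simp
next
  case False
  have 1: "normal_density m t y = normal_density 0 t (y - m)" for m t y :: real
    by (simp add: normal_density_def)
  have 2: "\<bar>c\<bar> * normal_density 0 \<bar>c\<bar> (c * h) = std_normal_density h" for h
    using False by (simp add: normal_density_def std_normal_density_def power_mult_distrib real_sqrt_mult)
  have "ennreal (normal_density m (sqrt (s\<^sup>2 + c\<^sup>2)) y) = ennreal (normal_density 0 (sqrt (s\<^sup>2 + \<bar>c\<bar>\<^sup>2)) (y - m))"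
    unfolding 1[of m] by simp
  also have "\<dots> = (\<integral>\<^sup>+z. ennreal (normal_density 0 s (y - m - z) * normal_density 0 \<bar>c\<bar> z) \<partial>lborel)"
    using conv_normal_density_zero_mean[of s "\<bar>c\<bar>"] s False by (auto dest: fun_cong[where x = "y - m"])
  also have "\<dots> = \<bar>c\<bar> * (\<integral>\<^sup>+h. ennreal (normal_density 0 s (y - m - (0 + c * h)) * normal_density 0 \<bar>c\<bar> (0 + c * h)) \<partial>lborel)"
    using False by (intro nn_integral_real_affine) auto
  also have "\<dots> = (\<integral>\<^sup>+h. \<bar>c\<bar> * ennreal (normal_density 0 s (y - m - (0 + c * h)) * normal_density 0 \<bar>c\<bar> (0 + c * h)) \<partial>lborel)"
    by (rule nn_integral_cmult[symmetric]) measurable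
  also have "\<dots> = (\<integral>\<^sup>+h. ennreal (std_normal_density h) * ennreal (normal_density (m + c * h) s y) \<partial>lborel)"
    unfolding 1[of "m + c * _"] 2[symmetric]
    by (intro nn_integral_cong) (simp add: ennreal_mult[symmetric] algebra_simps)
  also have "\<dots> = (\<integral>\<^sup>+h. ennreal (normal_density (m + c * h) s y) \<partial>std_normal)"
    by (rule nn_integral_std_normal[symmetric]) measurable
  finally show ?thesis ..
qed

text \<open>Two factorizations of the joint density of \<open>(g, y)\<close>: prior times likelihood
  on the left, the marginal \<open>N(0, v)\<close> of \<open>y\<close> times the posterior of
  \<open>g\<close> on the right. The exponents agree by completing the square.\<close>

lemma normal_density_Bayes:
  assumes v: "a\<^sup>2 < v"
  shows "std_normal_density g * normal_density (a * g) (sqrt (v - a\<^sup>2)) y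
    = normal_density 0 (sqrt v) y * normal_density (a * y / v) (sqrt ((v - a\<^sup>2) / v)) g"
proof -
  have v0: "0 < v" using v by (smt (verit) zero_le_power2)
  define d where "d = v - a\<^sup>2"
  have d: "0 < d" using v by (simp add: d_def)
  have "g\<^sup>2 / 2 + (y - a * g)\<^sup>2 / (2 * d) = y\<^sup>2 / (2 * v) + (g - a * y / v)\<^sup>2 / (2 * (d / v))"
  proof -
    have "(d + a\<^sup>2) * (g\<^sup>2 * d + (y - a * g)\<^sup>2) = y\<^sup>2 * d + ((d + a\<^sup>2) * g - a * y)\<^sup>2"
      by (simp add: power2_eq_square algebra_simps)
    then have *: "v * (g\<^sup>2 * d + (y - a * g)\<^sup>2) = y\<^sup>2 * d + (v * g - a * y)\<^sup>2" by (simp add: d_def)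
    have "g - a * y / v = (v * g - a * y) / v" using v0 by (simp add: field_simps)
    then have "y\<^sup>2 / (2 * v) + (g - a * y / v)\<^sup>2 / (2 * (d / v)) = (y\<^sup>2 * d + (v * g - a * y)\<^sup>2) / (2 * v * d)"
      using v0 d by (simp add: power_divide add_divide_distrib power2_eq_square)
    also have "\<dots> = g\<^sup>2 / 2 + (y - a * g)\<^sup>2 / (2 * d)"
      unfolding *[symmetric] using v0 d by (simp add: add_divide_distrib)
    finally show ?thesis ..
  qed
  then have "exp (- (g\<^sup>2 / 2)) * exp (- ((y - a * g)\<^sup>2 / (2 * d))) = exp (- (y\<^sup>2 / (2 * v))) * exp (- ((g - a * y / v)\<^sup>2 / (2 * (d / v))))"
    unfolding exp_add[symmetric] by simp
  moreover have "sqrt (2 * pi) * sqrt (2 * pi * d) = sqrt (2 * pi * v) * sqrt (2 * pi * (d / v))"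
    using v0 by (simp add: real_sqrt_mult[symmetric])
  ultimately have "(1 / (sqrt (2 * pi) * sqrt (2 * pi * d))) * (exp (- (g\<^sup>2 / 2)) * exp (- ((y - a * g)\<^sup>2 / (2 * d))))
     = (1 / (sqrt (2 * pi * v) * sqrt (2 * pi * (d / v)))) * (exp (- (y\<^sup>2 / (2 * v))) * exp (- ((g - a * y / v)\<^sup>2 / (2 * (d / v)))))"
    by simp
  then show ?thesis unfolding d_def[symmetric]
    using v0 d by (simp add: normal_density_def std_normal_density_def)
qed

text \<open>The argument also appears in the mean, so the integrand is a centered density evaluated
  at \<open>(1 - \<omega>) * y\<close>, and rescaling produces the constant.\<close>

lemma nn_integral_normal_density_shrink:
  assumes "\<omega> < 1" "0 < s"
  shows "(\<integral>\<^sup>+y. ennreal (normal_density (\<omega> * y) s y) \<partial>lborel) = ennreal (1 / (1 - \<omega>))"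
proof -
  have 1: "normal_density (\<omega> * y) s y = normal_density 0 s ((1 - \<omega>) * y)" for y
    by (simp add: normal_density_def algebra_simps)
  have "1 = (\<integral>\<^sup>+y. ennreal (normal_density 0 s y) \<partial>lborel)"
    using assms by (subst nn_integral_eq_integral) auto
  also have "\<dots> = \<bar>1 - \<omega>\<bar> * (\<integral>\<^sup>+y. ennreal (normal_density 0 s (0 + (1 - \<omega>) * y)) \<partial>lborel)"
    using assms by (intro nn_integral_real_affine) auto
  also have "\<dots> = ennreal (1 - \<omega>) * (\<integral>\<^sup>+y. ennreal (normal_density (\<omega> * y) s y) \<partial>lborel)"
    using assms by (simp add: 1)
  finally have "1 = ennreal (1 - \<omega>) * (\<integral>\<^sup>+y. ennreal (normal_density (\<omega> * y) s y) \<partial>lborel)" .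
  then have "ennreal (1 / (1 - \<omega>)) * 1 = (ennreal (1 / (1 - \<omega>)) * ennreal (1 - \<omega>)) * (\<integral>\<^sup>+y. ennreal (normal_density (\<omega> * y) s y) \<partial>lborel)"
    by (simp only: mult.assoc)
  also have "ennreal (1 / (1 - \<omega>)) * ennreal (1 - \<omega>) = 1"
    using assms by (simp add: ennreal_mult[symmetric])
  finally show ?thesis by simp
qed

text \<open>Integrating out \<open>h\<close> restores the variance \<open>v - b\<^sup>2\<close>;
  Bayes' rule then turns the prior, the first likelihood and the denominator into the posterior of
  \<open>g\<close> given \<open>y\<close>. Integrating \<open>g\<close> gives a normal density in
  \<open>y\<close> with mean \<open>a * b / v * y\<close>, whose total mass is
  \<open>1 / (1 - a * b / v)\<close>.\<close>

lemma correlated_pair_second_moment: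
  assumes a: "a\<^sup>2 < v" and bc: "b\<^sup>2 + c\<^sup>2 < v"
  shows "(\<integral>\<^sup>+y. \<integral>\<^sup>+g. \<integral>\<^sup>+h. ennreal (normal_density (a * g) (sqrt (v - a\<^sup>2)) y
      * normal_density (b * g + c * h) (sqrt (v - (b\<^sup>2 + c\<^sup>2))) y / normal_density 0 (sqrt v) y) \<partial>std_normal \<partial>std_normal \<partial>lborel)
    = ennreal (1 / (1 - a * b / v))"
proof -
  have v0: "0 < v" using a by (smt (verit) zero_le_power2)
  have b: "b\<^sup>2 < v" using bc by (smt (verit) zero_le_power2)
  define \<sigma> where "\<sigma> = sqrt ((sqrt (v - b\<^sup>2))\<^sup>2 + (b * sqrt ((v - a\<^sup>2) / v))\<^sup>2)"
  have \<sigma>: "0 < \<sigma>" using b by (simp add: \<sigma>_def add_pos_nonneg)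
  have "a * b < v"
  proof -
    have "0 \<le> (a - b)\<^sup>2" by simp
    then show ?thesis using a b by (simp add: power2_eq_square algebra_simps)
  qed
  then have \<omega>: "a * b / v < 1" using v0 by simp
  have inner: "(\<integral>\<^sup>+g. \<integral>\<^sup>+h. ennreal (normal_density (a * g) (sqrt (v - a\<^sup>2)) y
      * normal_density (b * g + c * h) (sqrt (v - (b\<^sup>2 + c\<^sup>2))) y / normal_density 0 (sqrt v) y) \<partial>std_normal \<partial>std_normal)
    = ennreal (normal_density (a * b / v * y) \<sigma> y)" for y
  proof -
    let ?n0 = "normal_density 0 (sqrt v) y"
    let ?n1 = "\<lambda>g. normal_density (a * g) (sqrt (v - a\<^sup>2)) y"
    let ?n2 = "\<lambda>g. normal_density (b * g) (sqrt (v - b\<^sup>2)) y"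
    let ?t = "sqrt ((v - a\<^sup>2) / v)"
    have n0: "0 < ?n0" using v0 by (simp add: normal_density_pos)
    have t: "0 < ?t" using a v0 by simp
    have "(\<integral>\<^sup>+h. ennreal (?n1 g * normal_density (b * g + c * h) (sqrt (v - (b\<^sup>2 + c\<^sup>2))) y / ?n0) \<partial>std_normal)
       = ennreal (?n1 g / ?n0) * ennreal (?n2 g)" for g
    proof -
      have "(\<integral>\<^sup>+h. ennreal (?n1 g * normal_density (b * g + c * h) (sqrt (v - (b\<^sup>2 + c\<^sup>2))) y / ?n0) \<partial>std_normal)
        = (\<integral>\<^sup>+h. ennreal (?n1 g / ?n0) * ennreal (normal_density (b * g + c * h) (sqrt (v - (b\<^sup>2 + c\<^sup>2))) y) \<partial>std_normal)"
        by (intro nn_integral_cong) (simp add: ennreal_mult[symmetric])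
      also have "\<dots> = ennreal (?n1 g / ?n0) * (\<integral>\<^sup>+h. ennreal (normal_density (b * g + c * h) (sqrt (v - (b\<^sup>2 + c\<^sup>2))) y) \<partial>std_normal)"
        by (rule nn_integral_cmult) measurable
      also have "(\<integral>\<^sup>+h. ennreal (normal_density (b * g + c * h) (sqrt (v - (b\<^sup>2 + c\<^sup>2))) y) \<partial>std_normal) = ennreal (?n2 g)"
        using bc by (subst std_normal_mixture) auto
      finally show ?thesis .
    qed
    then have "(\<integral>\<^sup>+g. \<integral>\<^sup>+h. ennreal (?n1 g * normal_density (b * g + c * h) (sqrt (v - (b\<^sup>2 + c\<^sup>2))) y / ?n0) \<partial>std_normal \<partial>std_normal)
      = (\<integral>\<^sup>+g. ennreal (?n1 g / ?n0) * ennreal (?n2 g) \<partial>std_normal)" by simp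
    also have "\<dots> = (\<integral>\<^sup>+g. ennreal (std_normal_density g) * (ennreal (?n1 g / ?n0) * ennreal (?n2 g)) \<partial>lborel)"
      by (rule nn_integral_std_normal) measurable
    also have "\<dots> = (\<integral>\<^sup>+g. ennreal (normal_density (a * y / v) ?t g * ?n2 g) \<partial>lborel)"
    proof (rule nn_integral_cong)
      fix g
      have "std_normal_density g * (?n1 g / ?n0 * ?n2 g) = (std_normal_density g * ?n1 g) / ?n0 * ?n2 g" by simp
      also have "\<dots> = normal_density (a * y / v) ?t g * ?n2 g"
        unfolding normal_density_Bayes[OF a] using n0 by simp
      finally show "ennreal (std_normal_density g) * (ennreal (?n1 g / ?n0) * ennreal (?n2 g)) = ennreal (normal_density (a * y / v) ?t g * ?n2 g)"
        by (simp add: ennreal_mult[symmetric])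
    qed
    \<comment> \<open>Standardizing the posterior, \<open>g = a * y / v + t * z\<close>, makes
      \<open>std_normal_mixture\<close> applicable a second time.\<close>
    also have "\<dots> = \<bar>?t\<bar> * (\<integral>\<^sup>+z. ennreal (normal_density (a * y / v) ?t (a * y / v + ?t * z) * ?n2 (a * y / v + ?t * z)) \<partial>lborel)"
      using t by (intro nn_integral_real_affine) auto
    also have "\<dots> = (\<integral>\<^sup>+z. \<bar>?t\<bar> * ennreal (normal_density (a * y / v) ?t (a * y / v + ?t * z) * ?n2 (a * y / v + ?t * z)) \<partial>lborel)"
      by (rule nn_integral_cmult[symmetric]) measurable
    also have "\<dots> = (\<integral>\<^sup>+z. ennreal (std_normal_density z) * ennreal (normal_density (a * b / v * y + b * ?t * z) (sqrt (v - b\<^sup>2)) y) \<partial>lborel)"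
    proof (rule nn_integral_cong)
      fix z
      have "\<bar>t\<bar> * normal_density m t (m + t * z) = std_normal_density z" if "0 < t" for t m :: real
        using that by (simp add: normal_density_def std_normal_density_def power_mult_distrib real_sqrt_mult)
      from this[OF t] have "\<bar>?t\<bar> * (normal_density (a * y / v) ?t (a * y / v + ?t * z) * ?n2 (a * y / v + ?t * z))
         = std_normal_density z * ?n2 (a * y / v + ?t * z)" by (simp only: mult.assoc[symmetric])
      moreover have "b * (a * y / v + ?t * z) = a * b / v * y + b * ?t * z" by (simp add: algebra_simps)
      ultimately show "ennreal \<bar>?t\<bar> * ennreal (normal_density (a * y / v) ?t (a * y / v + ?t * z) * ?n2 (a * y / v + ?t * z))
         = ennreal (std_normal_density z) * ennreal (normal_density (a * b / v * y + b * ?t * z) (sqrt (v - b\<^sup>2)) y)"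
        by (simp only: ennreal_mult[symmetric] abs_ge_zero normal_density_nonneg mult_nonneg_nonneg)
    qed
    also have "\<dots> = (\<integral>\<^sup>+z. ennreal (normal_density (a * b / v * y + b * ?t * z) (sqrt (v - b\<^sup>2)) y) \<partial>std_normal)"
      by (rule nn_integral_std_normal[symmetric]) measurable
    also have "\<dots> = ennreal (normal_density (a * b / v * y) \<sigma> y)"
      unfolding \<sigma>_def using b by (intro std_normal_mixture) simp
    finally show ?thesis .
  qed
  show ?thesis unfolding inner using nn_integral_normal_density_shrink[OF \<omega> \<sigma>] .
qed

subsection \<open>Second moments of likelihood ratios\<close>

text \<open>The design density occurs only once because in \<open>L * L' / L0\<close> one copy
  cancels. After splitting off the response \<open>(i, 0)\<close>, the two regressions are linear
  forms in the design coordinates and \<open>std_normal_pair_law\<close> applies.\<close>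

lemma row_second_moment:
  fixes \<theta> \<theta>' :: "nat \<Rightarrow> real" and i :: nat
  assumes \<theta>: "sqnorm p \<theta> < v" and \<theta>': "sqnorm p \<theta>' < v"
  shows "(\<integral>\<^sup>+\<omega>. ennreal (normal_density (\<Sum>j<p. \<theta> j * \<omega> (i, Suc j)) (sqrt (v - sqnorm p \<theta>)) (\<omega> (i, 0))
      * normal_density (\<Sum>j<p. \<theta>' j * \<omega> (i, Suc j)) (sqrt (v - sqnorm p \<theta>')) (\<omega> (i, 0))
      / normal_density 0 (sqrt v) (\<omega> (i, 0)) * (\<Prod>j<p. std_normal_density (\<omega> (i, Suc j))))
      \<partial>PiM ({i} \<times> {..<Suc p}) (\<lambda>_. lborel))
    = ennreal (1 / (1 - (\<Sum>j<p. \<theta> j * \<theta>' j) / v))"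
proof -
  interpret product_sigma_finite "\<lambda>_::nat \<times> nat. lborel :: real measure" ..
  define K where "K = (\<lambda>j. (i, Suc j)) ` {..<p}"
  have inj: "inj_on (\<lambda>j. (i, Suc j)) {..<p}" by (auto simp: inj_on_def)
  have K: "finite K" "(i, 0) \<notin> K" by (auto simp: K_def)
  have idx: "{i} \<times> {..<Suc p} = insert (i, 0) K"
    by (auto simp: K_def lessThan_Suc_eq_insert_0)
  have sumK: "(\<Sum>j<p. f (i, Suc j)) = sum f K" for f :: "nat \<times> nat \<Rightarrow> real"
    unfolding K_def by (simp add: sum.reindex[OF inj])
  have prodK: "(\<Prod>j<p. f (i, Suc j)) = prod f K" for f :: "nat \<times> nat \<Rightarrow> real"
    unfolding K_def by (simp add: prod.reindex[OF inj])
  \<comment> \<open>The predecessor undoes the shift by which column \<open>Suc j\<close> holds the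
    covariate \<open>j\<close>.\<close>
  define u where "u = (\<lambda>l::nat \<times> nat. \<theta> (snd l - 1))"
  define w where "w = (\<lambda>l::nat \<times> nat. \<theta>' (snd l - 1))"
  have lin: "(\<Sum>j<p. \<theta> j * \<omega> (i, Suc j)) = (\<Sum>l\<in>K. u l * \<omega> l)"
     "(\<Sum>j<p. \<theta>' j * \<omega> (i, Suc j)) = (\<Sum>l\<in>K. w l * \<omega> l)" for \<omega>
    by (simp_all add: sumK[symmetric] u_def w_def)
  have gram: "(\<Sum>l\<in>K. (u l)\<^sup>2) = sqnorm p \<theta>" "(\<Sum>l\<in>K. (w l)\<^sup>2) = sqnorm p \<theta>'" "(\<Sum>l\<in>K. u l * w l) = (\<Sum>j<p. \<theta> j * \<theta>' j)"
    by (simp_all add: sumK[symmetric] u_def w_def sqnorm_def)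
  obtain a b c where abc: "a\<^sup>2 = (\<Sum>l\<in>K. (u l)\<^sup>2)" "a * b = (\<Sum>l\<in>K. u l * w l)" "b\<^sup>2 + c\<^sup>2 = (\<Sum>l\<in>K. (w l)\<^sup>2)"
    and law: "\<forall>F :: real \<Rightarrow> real \<Rightarrow> ennreal. case_prod F \<in> borel_measurable (borel \<Otimes>\<^sub>M borel) \<longrightarrow>
      (\<integral>\<^sup>+x. ennreal (\<Prod>l\<in>K. std_normal_density (x l)) * F (\<Sum>l\<in>K. u l * x l) (\<Sum>l\<in>K. w l * x l) \<partial>PiM K (\<lambda>_. lborel))
      = (\<integral>\<^sup>+g. \<integral>\<^sup>+h. F (a * g) (b * g + c * h) \<partial>std_normal \<partial>std_normal)"
    using std_normal_pair_law[OF K(1), of u w] by (elim exE conjE) (rule that)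
  let ?s = "sqrt (v - sqnorm p \<theta>)" and ?s' = "sqrt (v - sqnorm p \<theta>')"
  have upd: "(\<Prod>l\<in>K. std_normal_density ((x((i, 0) := y)) l)) = (\<Prod>l\<in>K. std_normal_density (x l))"
      "(\<Sum>l\<in>K. r l * (x((i, 0) := y)) l) = (\<Sum>l\<in>K. r l * x l)" for x :: "nat \<times> nat \<Rightarrow> real" and y and r :: "nat \<times> nat \<Rightarrow> real"
    using K by (auto intro!: prod.cong sum.cong)
  have "(\<integral>\<^sup>+\<omega>. ennreal (normal_density (\<Sum>j<p. \<theta> j * \<omega> (i, Suc j)) ?s (\<omega> (i, 0))
      * normal_density (\<Sum>j<p. \<theta>' j * \<omega> (i, Suc j)) ?s' (\<omega> (i, 0))
      / normal_density 0 (sqrt v) (\<omega> (i, 0)) * (\<Prod>j<p. std_normal_density (\<omega> (i, Suc j))))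
      \<partial>PiM ({i} \<times> {..<Suc p}) (\<lambda>_. lborel))
    = (\<integral>\<^sup>+\<omega>. ennreal (normal_density (\<Sum>l\<in>K. u l * \<omega> l) ?s (\<omega> (i, 0))
      * normal_density (\<Sum>l\<in>K. w l * \<omega> l) ?s' (\<omega> (i, 0))
      / normal_density 0 (sqrt v) (\<omega> (i, 0)) * (\<Prod>l\<in>K. std_normal_density (\<omega> l)))
      \<partial>PiM (insert (i, 0) K) (\<lambda>_. lborel))"
    unfolding idx lin prodK[of "\<lambda>l. std_normal_density (_ l)"] ..
  also have "\<dots> = (\<integral>\<^sup>+y. \<integral>\<^sup>+x. ennreal (normal_density (\<Sum>l\<in>K. u l * (x((i, 0) := y)) l) ?s ((x((i, 0) := y)) (i, 0))
      * normal_density (\<Sum>l\<in>K. w l * (x((i, 0) := y)) l) ?s' ((x((i, 0) := y)) (i, 0))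
      / normal_density 0 (sqrt v) ((x((i, 0) := y)) (i, 0)) * (\<Prod>l\<in>K. std_normal_density ((x((i, 0) := y)) l)))
      \<partial>PiM K (\<lambda>_. lborel) \<partial>lborel)"
    using K by (intro product_nn_integral_insert_rev) auto
  also have "\<dots> = (\<integral>\<^sup>+y. \<integral>\<^sup>+x. ennreal (\<Prod>l\<in>K. std_normal_density (x l)) * ennreal (normal_density (\<Sum>l\<in>K. u l * x l) ?s y
      * normal_density (\<Sum>l\<in>K. w l * x l) ?s' y / normal_density 0 (sqrt v) y) \<partial>PiM K (\<lambda>_. lborel) \<partial>lborel)"
    unfolding upd fun_upd_same
    by (intro nn_integral_cong) (simp add: ennreal_mult[symmetric] prod_nonneg mult.commute)
  also have "\<dots> = (\<integral>\<^sup>+y. \<integral>\<^sup>+g. \<integral>\<^sup>+h. ennreal (normal_density (a * g) ?s y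
      * normal_density (b * g + c * h) ?s' y / normal_density 0 (sqrt v) y) \<partial>std_normal \<partial>std_normal \<partial>lborel)"
  proof (rule nn_integral_cong)
    fix y :: real
    show "(\<integral>\<^sup>+x. ennreal (\<Prod>l\<in>K. std_normal_density (x l)) * ennreal (normal_density (\<Sum>l\<in>K. u l * x l) ?s y
      * normal_density (\<Sum>l\<in>K. w l * x l) ?s' y / normal_density 0 (sqrt v) y) \<partial>PiM K (\<lambda>_. lborel))
      = (\<integral>\<^sup>+g. \<integral>\<^sup>+h. ennreal (normal_density (a * g) ?s y
      * normal_density (b * g + c * h) ?s' y / normal_density 0 (sqrt v) y) \<partial>std_normal \<partial>std_normal)"
      by (rule law[rule_format, of "\<lambda>A B. ennreal (normal_density A ?s y * normal_density B ?s' y / normal_density 0 (sqrt v) y)"]) measurable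
  qed
  also have "\<dots> = ennreal (1 / (1 - a * b / v))"
    using correlated_pair_second_moment[of a v b c] \<theta> \<theta>' by (simp only: abc gram)
  finally show ?thesis by (simp only: abc gram)
qed

text \<open>Independence of the observations, by Fubini one row at a time. Measurability is asked
  over every index set containing row \<open>i\<close>, since \<open>f i\<close> is integrated over
  a single row as well as over all rows; the locality hypothesis is what evaluates
  \<open>f i\<close> on a merged point.\<close>

lemma nn_integral_prod_rows:
  fixes f :: "nat \<Rightarrow> (nat \<times> nat \<Rightarrow> real) \<Rightarrow> ennreal"
  assumes A: "finite A"
    and meas: "\<And>i I. {i} \<times> A \<subseteq> I \<Longrightarrow> f i \<in> borel_measurable (PiM I (\<lambda>_. lborel))"
    and dep: "\<And>i \<omega> \<omega>'. (\<And>j. j \<in> A \<Longrightarrow> \<omega> (i, j) = \<omega>' (i, j)) \<Longrightarrow> f i \<omega> = f i \<omega>'"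
  shows "(\<integral>\<^sup>+\<omega>. (\<Prod>i<n. f i \<omega>) \<partial>PiM ({..<n} \<times> A) (\<lambda>_. lborel))
    = (\<Prod>i<n. \<integral>\<^sup>+\<omega>. f i \<omega> \<partial>PiM ({i} \<times> A) (\<lambda>_. lborel))"
proof (induction n)
  case 0
  then show ?case by (simp add: PiM_empty)
next
  case (Suc n)
  interpret product_sigma_finite "\<lambda>_::nat \<times> nat. lborel :: real measure" ..
  let ?I = "{..<n} \<times> A" and ?J = "{n} \<times> A"
  have split: "{..<Suc n} \<times> A = ?I \<union> ?J" by (auto simp: less_Suc_eq)
  have m1: "(\<lambda>\<omega>. \<Prod>i<n. f i \<omega>) \<in> borel_measurable (PiM ?I (\<lambda>_. lborel))"
    by (intro borel_measurable_prod_ennreal meas) auto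
  have m2: "f n \<in> borel_measurable (PiM ?J (\<lambda>_. lborel))" by (rule meas) auto
  have merge1: "f i (merge ?I ?J (x, y)) = f i x" if "i < n" for i x y
    using that by (intro dep) (auto simp: merge_def)
  have merge2: "f n (merge ?I ?J (x, y)) = f n y" for x y
    by (intro dep) (auto simp: merge_def)
  have "(\<integral>\<^sup>+\<omega>. (\<Prod>i<Suc n. f i \<omega>) \<partial>PiM ({..<Suc n} \<times> A) (\<lambda>_. lborel))
    = (\<integral>\<^sup>+x. \<integral>\<^sup>+y. (\<Prod>i<Suc n. f i (merge ?I ?J (x, y))) \<partial>PiM ?J (\<lambda>_. lborel) \<partial>PiM ?I (\<lambda>_. lborel))"
    unfolding split using A by (intro product_nn_integral_fold borel_measurable_prod_ennreal meas) auto
  also have "\<dots> = (\<integral>\<^sup>+x. \<integral>\<^sup>+y. (\<Prod>i<n. f i x) * f n y \<partial>PiM ?J (\<lambda>_. lborel) \<partial>PiM ?I (\<lambda>_. lborel))"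
    by (simp add: merge1 merge2)
  also have "\<dots> = (\<integral>\<^sup>+x. (\<Prod>i<n. f i x) * (\<integral>\<^sup>+y. f n y \<partial>PiM ?J (\<lambda>_. lborel)) \<partial>PiM ?I (\<lambda>_. lborel))"
    using m2 by (simp add: nn_integral_cmult)
  also have "\<dots> = (\<integral>\<^sup>+x. (\<Prod>i<n. f i x) \<partial>PiM ?I (\<lambda>_. lborel)) * (\<integral>\<^sup>+y. f n y \<partial>PiM ?J (\<lambda>_. lborel))"
    using m1 by (rule nn_integral_multc)
  finally show ?case using Suc by simp
qed

text \<open>The density of \<open>P_law\<close>, kept real-valued so that quotients and Bochner
  integrals are available.\<close>

definition lik :: "real \<Rightarrow> nat \<Rightarrow> nat \<Rightarrow> (nat \<Rightarrow> real) \<Rightarrow> (nat \<times> nat \<Rightarrow> real) \<Rightarrow> real" where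
  "lik v n p \<theta> \<omega> = (\<Prod>i<n.
        normal_density (\<Sum>j<p. \<theta> j * \<omega> (i, Suc j)) (sqrt (v - sqnorm p \<theta>)) (\<omega> (i, 0))
        * (\<Prod>j<p. std_normal_density (\<omega> (i, Suc j))))"

lemma P_law_eq: "P_law v n p \<theta> = density (obs_space n p) (\<lambda>\<omega>. ennreal (lik v n p \<theta> \<omega>))"
  by (simp add: P_law_def lik_def)

lemma lik_nonneg: "0 \<le> lik v n p \<theta> \<omega>"
  by (simp add: lik_def prod_nonneg)

lemma lik_pos: "sqnorm p \<theta> < v \<Longrightarrow> 0 < lik v n p \<theta> \<omega>"
  by (auto simp: lik_def intro!: prod_pos mult_pos_pos normal_density_pos)

lemma measurable_coordinate_sums:
  fixes \<theta> :: "nat \<Rightarrow> real" and i :: nat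
  assumes "{i} \<times> {..<Suc p} \<subseteq> I"
  shows "(\<lambda>\<omega>::nat \<times> nat \<Rightarrow> real. \<omega> (i, 0)) \<in> borel_measurable (PiM I (\<lambda>_. lborel))"
    "(\<lambda>\<omega>::nat \<times> nat \<Rightarrow> real. \<Sum>j<p. \<theta> j * \<omega> (i, Suc j)) \<in> borel_measurable (PiM I (\<lambda>_. lborel))"
    "(\<lambda>\<omega>::nat \<times> nat \<Rightarrow> real. \<Prod>j<p. std_normal_density (\<omega> (i, Suc j))) \<in> borel_measurable (PiM I (\<lambda>_. lborel))"
proof -
  have coord: "(\<lambda>\<omega>::nat \<times> nat \<Rightarrow> real. \<omega> (i, j)) \<in> borel_measurable (PiM I (\<lambda>_. lborel))" if "j < Suc p" for j
    using measurable_component_singleton[of "(i, j)" I "\<lambda>_. lborel"] assms that by auto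
  show "(\<lambda>\<omega>::nat \<times> nat \<Rightarrow> real. \<omega> (i, 0)) \<in> borel_measurable (PiM I (\<lambda>_. lborel))" by (rule coord) simp
  show "(\<lambda>\<omega>::nat \<times> nat \<Rightarrow> real. \<Sum>j<p. \<theta> j * \<omega> (i, Suc j)) \<in> borel_measurable (PiM I (\<lambda>_. lborel))"
  proof (rule borel_measurable_sum)
    fix j assume "j \<in> {..<p}"
    then have [measurable]: "(\<lambda>\<omega>::nat \<times> nat \<Rightarrow> real. \<omega> (i, Suc j)) \<in> borel_measurable (PiM I (\<lambda>_. lborel))"
      by (intro coord) simp
    show "(\<lambda>\<omega>::nat \<times> nat \<Rightarrow> real. \<theta> j * \<omega> (i, Suc j)) \<in> borel_measurable (PiM I (\<lambda>_. lborel))" by measurable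
  qed
  show "(\<lambda>\<omega>::nat \<times> nat \<Rightarrow> real. \<Prod>j<p. std_normal_density (\<omega> (i, Suc j))) \<in> borel_measurable (PiM I (\<lambda>_. lborel))"
    by (intro borel_measurable_prod borel_measurable_normal_density[THEN measurable_compose[rotated]] coord) auto
qed

lemma measurable_lik [measurable]: "lik v n p \<theta> \<in> borel_measurable (obs_space n p)"
  unfolding lik_def[abs_def] obs_space_def
proof (rule borel_measurable_prod)
  fix i assume "i \<in> {..<n}"
  then have "{i} \<times> {..<Suc p} \<subseteq> {..<n} \<times> {..<Suc p}" by auto
  note [measurable] = measurable_coordinate_sums[OF this]
  show "(\<lambda>\<omega>. normal_density (\<Sum>j<p. \<theta> j * \<omega> (i, Suc j)) (sqrt (v - sqnorm p \<theta>)) (\<omega> (i, 0)) *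
      (\<Prod>j<p. std_normal_density (\<omega> (i, Suc j)))) \<in> borel_measurable (Pi\<^sub>M ({..<n} \<times> {..<Suc p}) (\<lambda>_. lborel))"
    by measurable
qed

lemma sqnorm_0 [simp]: "sqnorm p (\<lambda>_. 0) = 0"
  by (simp add: sqnorm_def)

text \<open>By polarization the inner product is at most the mean of the two squared norms. This
  keeps \<open>1 - \<langle>\<theta>, \<theta>'\<rangle> / v\<close> positive.\<close>

lemma inner_lt_of_sqnorm_lt:
  assumes "sqnorm p \<theta> < v" "sqnorm p \<theta>' < v"
  shows "(\<Sum>j<p. \<theta> j * \<theta>' j) < v"
proof -
  have "0 \<le> (\<Sum>j<p. (\<theta> j - \<theta>' j)\<^sup>2)" by (simp add: sum_nonneg)
  also have "\<dots> = sqnorm p \<theta> + sqnorm p \<theta>' - 2 * (\<Sum>j<p. \<theta> j * \<theta>' j)"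
    by (simp add: sqnorm_def power2_diff sum.distrib sum_subtractf sum_distrib_left mult.assoc)
  finally show ?thesis using assms by simp
qed

text \<open>The quotient factors over rows, and each row contributes the same one-observation
  moment. \<open>has_bochner_integral\<close> records integrability along with the value.\<close>

lemma lik_second_moment:
  assumes v: "0 < v" and \<theta>: "sqnorm p \<theta> < v" and \<theta>': "sqnorm p \<theta>' < v"
  shows "has_bochner_integral (obs_space n p) (\<lambda>\<omega>. lik v n p \<theta> \<omega> * lik v n p \<theta>' \<omega> / lik v n p (\<lambda>_. 0) \<omega>)
    ((1 / (1 - (\<Sum>j<p. \<theta> j * \<theta>' j) / v)) ^ n)"
proof (rule has_bochner_integral_nn_integral)
  define f where "f = (\<lambda>(i::nat) \<omega>. ennreal (normal_density (\<Sum>j<p. \<theta> j * \<omega> (i, Suc j)) (sqrt (v - sqnorm p \<theta>)) (\<omega> (i, 0))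
      * normal_density (\<Sum>j<p. \<theta>' j * \<omega> (i, Suc j)) (sqrt (v - sqnorm p \<theta>')) (\<omega> (i, 0))
      / normal_density 0 (sqrt v) (\<omega> (i, 0)) * (\<Prod>j<p. std_normal_density (\<omega> (i, Suc j)))))"
  have "ennreal (lik v n p \<theta> \<omega> * lik v n p \<theta>' \<omega> / lik v n p (\<lambda>_. 0) \<omega>) = (\<Prod>i<n. f i \<omega>)" for \<omega>
  proof -
    have cancel: "A * P * (B * P) / (C * P) = A * B / C * P" if "P > 0" for A B C P :: real
      using that by simp
    have pos: "(\<Prod>j<p. std_normal_density (\<omega> (i, Suc j))) > 0" for i
      by (intro prod_pos) (auto intro!: normal_density_pos)
    have "lik v n p \<theta> \<omega> * lik v n p \<theta>' \<omega> / lik v n p (\<lambda>_. 0) \<omega>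
      = (\<Prod>i<n. normal_density (\<Sum>j<p. \<theta> j * \<omega> (i, Suc j)) (sqrt (v - sqnorm p \<theta>)) (\<omega> (i, 0))
      * normal_density (\<Sum>j<p. \<theta>' j * \<omega> (i, Suc j)) (sqrt (v - sqnorm p \<theta>')) (\<omega> (i, 0))
      / normal_density 0 (sqrt v) (\<omega> (i, 0)) * (\<Prod>j<p. std_normal_density (\<omega> (i, Suc j))))"
      unfolding lik_def prod.distrib[symmetric] prod_dividef[symmetric] cancel[OF pos] by simp
    then show ?thesis unfolding f_def by (simp add: prod_ennreal prod_nonneg)
  qed
  then have "(\<integral>\<^sup>+\<omega>. ennreal (lik v n p \<theta> \<omega> * lik v n p \<theta>' \<omega> / lik v n p (\<lambda>_. 0) \<omega>) \<partial>obs_space n p)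
     = (\<integral>\<^sup>+\<omega>. (\<Prod>i<n. f i \<omega>) \<partial>PiM ({..<n} \<times> {..<Suc p}) (\<lambda>_. lborel))"
    by (simp add: obs_space_def)
  also have "\<dots> = (\<Prod>i<n. \<integral>\<^sup>+\<omega>. f i \<omega> \<partial>PiM ({i} \<times> {..<Suc p}) (\<lambda>_. lborel))"
  proof (rule nn_integral_prod_rows)
    fix i and I :: "(nat \<times> nat) set" assume "{i} \<times> {..<Suc p} \<subseteq> I"
    note [measurable] = measurable_coordinate_sums[OF this]
    show "f i \<in> borel_measurable (PiM I (\<lambda>_. lborel))"
      unfolding f_def by measurable
  next
    fix i :: nat and \<omega> \<omega>' :: "nat \<times> nat \<Rightarrow> real"
    assume "\<And>j. j \<in> {..<Suc p} \<Longrightarrow> \<omega> (i, j) = \<omega>' (i, j)"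
    then have "\<omega> (i, 0) = \<omega>' (i, 0)" "\<And>j. j < p \<Longrightarrow> \<omega> (i, Suc j) = \<omega>' (i, Suc j)" by auto
    then show "f i \<omega> = f i \<omega>'" by (simp add: f_def)
  qed simp
  also have "\<dots> = (\<Prod>i<n. ennreal (1 / (1 - (\<Sum>j<p. \<theta> j * \<theta>' j) / v)))"
    unfolding f_def row_second_moment[OF \<theta> \<theta>'] ..
  also have "\<dots> = ennreal ((1 / (1 - (\<Sum>j<p. \<theta> j * \<theta>' j) / v)) ^ n)"
    using v inner_lt_of_sqnorm_lt[OF \<theta> \<theta>'] by (simp add: ennreal_power)
  finally show "(\<integral>\<^sup>+\<omega>. ennreal (lik v n p \<theta> \<omega> * lik v n p \<theta>' \<omega> / lik v n p (\<lambda>_. 0) \<omega>) \<partial>obs_space n p)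
     = ennreal ((1 / (1 - (\<Sum>j<p. \<theta> j * \<theta>' j) / v)) ^ n)" .
  show "0 \<le> (1 / (1 - (\<Sum>j<p. \<theta> j * \<theta>' j) / v)) ^ n"
    using v inner_lt_of_sqnorm_lt[OF \<theta> \<theta>'] by simp
qed (auto simp: lik_nonneg)

text \<open>The case \<open>\<theta>' = 0\<close> of the cross moment: the inner product vanishes
  and one likelihood cancels.\<close>

lemma lik_has_integral_one:
  assumes "0 < v" "sqnorm p \<theta> < v"
  shows "has_bochner_integral (obs_space n p) (lik v n p \<theta>) 1"
proof -
  have "lik v n p (\<lambda>_. 0) \<omega> \<noteq> 0" for \<omega>
    using lik_pos[of p "\<lambda>_. 0" v n \<omega>] assms(1) by simp
  then have "(\<lambda>\<omega>. lik v n p \<theta> \<omega> * lik v n p (\<lambda>_. 0) \<omega> / lik v n p (\<lambda>_. 0) \<omega>) = lik v n p \<theta>"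
    by simp
  then show ?thesis using lik_second_moment[OF assms(1,2), of "\<lambda>_. 0" n] assms(1) by simp
qed

subsection \<open>From the second moment to the minimax risk\<close>

text \<open>For every \<open>h\<close>, the inequality \<open>(g - h * f0)\<^sup>2 \<ge> 0\<close>
  gives the lower bound \<open>2 * h * g - h\<^sup>2 * f0\<close> for \<open>g\<^sup>2 / f0\<close>.
  A two-valued \<open>h\<close> makes its integral computable from the masses of \<open>B\<close>;
  letting \<open>h\<close> vary on \<open>B\<close> and on its complement yields the factor
  \<open>4\<close>.\<close>

lemma chi_square_test_bound:
  fixes f0 g :: "'a \<Rightarrow> real"
  assumes f0: "has_bochner_integral M f0 1" "\<And>x. 0 < f0 x"
    and g: "has_bochner_integral M g 1"
    and X: "has_bochner_integral M (\<lambda>x. (g x)\<^sup>2 / f0 x) X"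
    and B: "B \<in> sets M"
  shows "4 * ((\<integral>x. indicator B x * f0 x \<partial>M) - (\<integral>x. indicator B x * g x \<partial>M))\<^sup>2 \<le> X - 1"
proof -
  define \<beta> where "\<beta> = (\<integral>x. indicator B x * f0 x \<partial>M)"
  define b where "b = (\<integral>x. indicator B x * g x \<partial>M)"
  \<comment> \<open>Compare \<open>g\<close> with \<open>h f0\<close>, where \<open>h = 1 - \<kappa>\<close> on \<open>B\<close> and \<open>h = 1 + \<kappa>\<close> off \<open>B\<close>; this \<open>\<kappa>\<close> is optimal.\<close>
  define \<kappa> where "\<kappa> = 2 * (\<beta> - b)"
  have i: "integrable M f0" "integrable M g" using f0 g by (auto simp: has_bochner_integral_iff)
  have 1: "has_bochner_integral M (\<lambda>x. indicator B x * f0 x) \<beta>"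
    unfolding \<beta>_def using integrable_mult_indicator[OF B i(1)] by (simp add: has_bochner_integral_integrable)
  have 2: "has_bochner_integral M (\<lambda>x. indicator B x * g x) b"
    unfolding b_def using integrable_mult_indicator[OF B i(2)] by (simp add: has_bochner_integral_integrable)
  have rhs: "has_bochner_integral M
    (\<lambda>x. (2 * (1 + \<kappa>) * g x - 4 * \<kappa> * (indicator B x * g x)) - ((1 + \<kappa>)\<^sup>2 * f0 x - 4 * \<kappa> * (indicator B x * f0 x)))
    ((2 * (1 + \<kappa>) * 1 - 4 * \<kappa> * b) - ((1 + \<kappa>)\<^sup>2 * 1 - 4 * \<kappa> * \<beta>))"
    by (intro has_bochner_integral_diff has_bochner_integral_mult_right 1 2 f0 g)
  have "(2 * (1 + \<kappa>) * g x - 4 * \<kappa> * (indicator B x * g x)) - ((1 + \<kappa>)\<^sup>2 * f0 x - 4 * \<kappa> * (indicator B x * f0 x))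
     \<le> (g x)\<^sup>2 / f0 x" for x
  proof -
    define h where "h = (if x \<in> B then 1 - \<kappa> else 1 + \<kappa>)"
    have "(2 * (1 + \<kappa>) * g x - 4 * \<kappa> * (indicator B x * g x)) - ((1 + \<kappa>)\<^sup>2 * f0 x - 4 * \<kappa> * (indicator B x * f0 x))
       = 2 * h * g x - h\<^sup>2 * f0 x"
      by (simp add: h_def power2_eq_square algebra_simps)
    moreover have "0 \<le> (g x - h * f0 x)\<^sup>2 / f0 x" using f0(2)[of x] by simp
    moreover have "(g x - h * f0 x)\<^sup>2 / f0 x = (g x)\<^sup>2 / f0 x - (2 * h * g x - h\<^sup>2 * f0 x)"
      using f0(2)[of x] by (simp add: field_simps power2_eq_square)
    ultimately show ?thesis by simp
  qed
  then have "(2 * (1 + \<kappa>) * 1 - 4 * \<kappa> * b) - ((1 + \<kappa>)\<^sup>2 * 1 - 4 * \<kappa> * \<beta>) \<le> X"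
    using has_bochner_integral_iff rhs X by (metis (no_types, lifting) integral_mono)
  then have "4 * (\<beta> - b)\<^sup>2 \<le> X - 1"
    by (simp add: \<kappa>_def power2_eq_square algebra_simps)
  then show ?thesis by (simp add: \<beta>_def b_def)
qed

lemma measure_P_law:
  assumes "0 < v" "sqnorm p \<theta> < v" and B: "B \<in> sets (obs_space n p)"
  shows "measure (P_law v n p \<theta>) B = (\<integral>\<omega>. indicator B \<omega> * lik v n p \<theta> \<omega> \<partial>obs_space n p)"
proof -
  have int: "integrable (obs_space n p) (lik v n p \<theta>)"
    using lik_has_integral_one[OF assms(1,2), of n] by (simp add: has_bochner_integral_iff)
  have "emeasure (P_law v n p \<theta>) B = (\<integral>\<^sup>+\<omega>. ennreal (indicator B \<omega> * lik v n p \<theta> \<omega>) \<partial>obs_space n p)"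
    unfolding P_law_eq using B
    by (subst emeasure_density) (auto intro!: nn_integral_cong split: split_indicator)
  also have "\<dots> = ennreal (\<integral>\<omega>. indicator B \<omega> * lik v n p \<theta> \<omega> \<partial>obs_space n p)"
    using integrable_mult_indicator[OF B int] by (intro nn_integral_eq_integral) (auto simp: lik_nonneg)
  finally show ?thesis
    by (simp add: measure_def integral_nonneg_AE lik_nonneg)
qed

lemma measure_P_law_le_1:
  assumes "0 < v" "sqnorm p \<theta> < v" and B: "B \<in> sets (obs_space n p)"
  shows "measure (P_law v n p \<theta>) B \<le> 1"
proof -
  have int: "integrable (obs_space n p) (lik v n p \<theta>)" "integral\<^sup>L (obs_space n p) (lik v n p \<theta>) = 1"
    using lik_has_integral_one[OF assms(1,2), of n] by (auto simp: has_bochner_integral_iff)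
  have "(\<integral>\<omega>. indicator B \<omega> * lik v n p \<theta> \<omega> \<partial>obs_space n p) \<le> integral\<^sup>L (obs_space n p) (lik v n p \<theta>)"
    using integrable_mult_indicator[OF B int(1)] int(1)
    by (intro integral_mono) (auto simp: lik_nonneg split: split_indicator)
  then show ?thesis using int by (simp add: measure_P_law[OF assms])
qed

text \<open>The worst-case type II error is at least its average under a prior, here the image under
  \<open>th\<close> of the uniform law on \<open>I\<close>; \<open>th\<close> need not be injective.
  The moment condition bounds the chi-square distance of the mixture \<open>g\<close> from the null
  density by \<open>4 * t\<^sup>2\<close>.\<close>

lemma beta_I_ge_of_prior:
  fixes th :: "'a \<Rightarrow> nat \<Rightarrow> real"
  assumes v: "0 < v" and I: "finite I" "I \<noteq> {}" and \<alpha>: "0 \<le> \<alpha>" and t: "0 \<le> t"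
    and \<Theta>: "\<And>\<theta>. \<theta> \<in> \<Theta> \<Longrightarrow> sqnorm p \<theta> < v" and th: "\<And>x. x \<in> I \<Longrightarrow> th x \<in> \<Theta>"
    and moment: "(\<Sum>x\<in>I. \<Sum>y\<in>I. (1 / (1 - (\<Sum>j<p. th x j * th y j) / v)) ^ n) \<le> (real (card I))\<^sup>2 * (1 + 4 * t\<^sup>2)"
  shows "1 - \<alpha> - t \<le> beta_I v n p \<alpha> \<Theta>"
  unfolding beta_I_def
proof (rule cINF_greatest)
  \<comment> \<open>The test that never rejects has every nonnegative level, so the infimum is over
    a nonempty set.\<close>
  have "{} \<in> {A. A \<in> sets (obs_space n p) \<and> measure (P_law v n p (\<lambda>_. 0)) A \<le> \<alpha>}"
    using \<alpha> by simp
  then show "{A. A \<in> sets (obs_space n p) \<and> measure (P_law v n p (\<lambda>_. 0)) A \<le> \<alpha>} \<noteq> {}" by blast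
next
  fix A assume "A \<in> {A. A \<in> sets (obs_space n p) \<and> measure (P_law v n p (\<lambda>_. 0)) A \<le> \<alpha>}"
  then have A: "A \<in> sets (obs_space n p)" "measure (P_law v n p (\<lambda>_. 0)) A \<le> \<alpha>" by auto
  let ?O = "obs_space n p"
  let ?f0 = "lik v n p (\<lambda>_. 0)"
  define B where "B = space ?O - A"
  have B: "B \<in> sets ?O" using A by (simp add: B_def)
  define N where "N = real (card I)"
  have N: "0 < N" using I by (simp add: N_def card_gt_0_iff)
  define g where "g = (\<lambda>\<omega>. (\<Sum>x\<in>I. lik v n p (th x) \<omega>) / N)"
  have sq: "sqnorm p (th x) < v" if "x \<in> I" for x using \<Theta> th that by blast
  have z: "sqnorm p (\<lambda>_. 0) < v" using v by simp
  have f0: "has_bochner_integral ?O ?f0 1" by (rule lik_has_integral_one[OF v z])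
  have "has_bochner_integral ?O g ((\<Sum>x\<in>I. 1) / N)"
    unfolding g_def by (intro has_bochner_integral_divide_zero has_bochner_integral_sum lik_has_integral_one v sq)
  then have g: "has_bochner_integral ?O g 1" using N by (simp add: N_def)
  define X where "X = (\<Sum>x\<in>I. \<Sum>y\<in>I. (1 / (1 - (\<Sum>j<p. th x j * th y j) / v)) ^ n) / N\<^sup>2"
  have "has_bochner_integral ?O (\<lambda>\<omega>. (\<Sum>x\<in>I. \<Sum>y\<in>I. lik v n p (th x) \<omega> * lik v n p (th y) \<omega> / ?f0 \<omega>) / N\<^sup>2) X"
    unfolding X_def by (intro has_bochner_integral_divide_zero has_bochner_integral_sum lik_second_moment v sq)
  moreover have "(\<Sum>x\<in>I. \<Sum>y\<in>I. lik v n p (th x) \<omega> * lik v n p (th y) \<omega> / ?f0 \<omega>) / N\<^sup>2 = (g \<omega>)\<^sup>2 / ?f0 \<omega>" for \<omega>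
  proof -
    have "(\<Sum>x\<in>I. \<Sum>y\<in>I. lik v n p (th x) \<omega> * lik v n p (th y) \<omega> / ?f0 \<omega>) = (\<Sum>x\<in>I. lik v n p (th x) \<omega>)\<^sup>2 / ?f0 \<omega>"
      by (simp add: power2_eq_square sum_product sum_divide_distrib)
    then show ?thesis by (simp add: g_def power_divide mult.commute)
  qed
  ultimately have X: "has_bochner_integral ?O (\<lambda>\<omega>. (g \<omega>)\<^sup>2 / ?f0 \<omega>) X" by simp
  have Xle: "X \<le> 1 + 4 * t\<^sup>2" using moment N by (simp add: X_def N_def field_simps)
  define \<beta> where "\<beta> = (\<integral>\<omega>. indicator B \<omega> * ?f0 \<omega> \<partial>?O)"
  define b where "b = (\<integral>\<omega>. indicator B \<omega> * g \<omega> \<partial>?O)"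
  have "4 * (\<beta> - b)\<^sup>2 \<le> X - 1"
    unfolding \<beta>_def b_def by (rule chi_square_test_bound[OF f0 lik_pos[OF z] g X B])
  then have "(\<beta> - b)\<^sup>2 \<le> t\<^sup>2" using Xle by simp
  then have diff: "\<beta> - t \<le> b" using t by (smt (verit) power2_le_imp_le)
  have \<beta>: "1 - \<alpha> \<le> \<beta>"
  proof -
    have "integrable ?O ?f0" "integral\<^sup>L ?O ?f0 = 1" using f0 by (auto simp: has_bochner_integral_iff)
    moreover have "\<beta> = (\<integral>\<omega>. ?f0 \<omega> - indicator A \<omega> * ?f0 \<omega> \<partial>?O)"
      unfolding \<beta>_def B_def by (intro Bochner_Integration.integral_cong) (auto split: split_indicator)
    ultimately have "\<beta> = 1 - measure (P_law v n p (\<lambda>_. 0)) A"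
      using integrable_mult_indicator[OF A(1), of ?f0] by (simp add: measure_P_law[OF v z A(1)])
    then show ?thesis using A by simp
  qed
  \<comment> \<open>Without an upper bound a real supremum need not dominate its members.\<close>
  have bdd: "bdd_above ((\<lambda>\<theta>. measure (P_law v n p \<theta>) B) ` \<Theta>)"
    using measure_P_law_le_1[OF v \<Theta> B] by (intro bdd_aboveI2[where M = 1])
  have "b = (\<Sum>x\<in>I. measure (P_law v n p (th x)) B) / N"
  proof -
    have int: "integrable ?O (\<lambda>\<omega>. indicator B \<omega> * lik v n p (th x) \<omega>)" if "x \<in> I" for x
      using integrable_mult_indicator[OF B, of "lik v n p (th x)"] lik_has_integral_one[OF v sq[OF that], of n]
      by (simp add: has_bochner_integral_iff)
    have "b = (\<integral>\<omega>. (\<Sum>x\<in>I. indicator B \<omega> * lik v n p (th x) \<omega>) / N \<partial>?O)"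
      by (simp add: b_def g_def sum_distrib_left)
    also have "\<dots> = (\<Sum>x\<in>I. \<integral>\<omega>. indicator B \<omega> * lik v n p (th x) \<omega> \<partial>?O) / N"
      using int by (simp add: integral_sum)
    finally show ?thesis using measure_P_law[OF v sq B] by simp
  qed
  also have "\<dots> \<le> (\<Sum>x\<in>I. (SUP \<theta>\<in>\<Theta>. measure (P_law v n p \<theta>) B)) / N"
    using N th bdd by (intro divide_right_mono sum_mono cSUP_upper) auto
  also have "\<dots> = (SUP \<theta>\<in>\<Theta>. measure (P_law v n p \<theta>) B)" using N by (simp add: N_def)
  finally show "1 - \<alpha> - t \<le> (SUP \<theta>\<in>\<Theta>. measure (P_law v n p \<theta>) (space (obs_space n p) - A))"
    using diff \<beta> by (simp add: B_def)
qed

section \<open>Second moment of the random signed sparse prior\<close>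

text \<open>Flipping all signs replaces \<open>G\<close> by its even part, which \<open>G\<close>
  dominates by \<open>cosh\<close>; the average of \<open>cosh (\<sigma> * Z)\<close> then factors
  over coordinates. Only coordinates in \<open>D\<close> contribute, so
  \<open>\<bar>Z\<bar> \<le> k\<close> as the bound on \<open>G\<close> demands.\<close>

lemma sum_signs_even_le:
  fixes G :: "real \<Rightarrow> real"
  assumes D: "D \<subseteq> {..<p}" "card D \<le> k"
    and G: "\<And>z. \<bar>z\<bar> \<le> real k \<Longrightarrow> (G z + G (- z)) / 2 \<le> cosh (\<sigma> * z)"
    and a: "\<And>j. j \<in> D \<Longrightarrow> \<bar>a j\<bar> = 1" "\<And>j. j \<notin> D \<Longrightarrow> a j = 0"
  shows "(\<Sum>T\<in>Pow {..<p}. G (\<Sum>j<p. sign_in T j * a j)) \<le> 2 ^ p * cosh \<sigma> ^ card D"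
proof -
  let ?Z = "\<lambda>T. \<Sum>j<p. sign_in T j * a j"
  have fin: "finite D" using D finite_subset by blast
  have Z: "\<bar>?Z T\<bar> \<le> real k" for T
  proof -
    have "\<bar>?Z T\<bar> \<le> (\<Sum>j<p. \<bar>sign_in T j * a j\<bar>)" by (rule sum_abs)
    also have "\<dots> = (\<Sum>j\<in>D. 1)"
      using D a by (intro sum.mono_neutral_cong_right) (auto simp: sign_in_def abs_mult)
    finally show ?thesis using D by simp
  qed
  have "(\<Sum>T\<in>Pow {..<p}. G (?Z T)) = (\<Sum>T\<in>Pow {..<p}. (G (?Z T) + G (- ?Z T)) / 2)"
    using sum_signs_flip[of G a p] by (simp add: sum.distrib sum_divide_distrib[symmetric])
  also have "\<dots> \<le> (\<Sum>T\<in>Pow {..<p}. cosh (\<sigma> * ?Z T))"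
    by (intro sum_mono G Z)
  also have "\<dots> = (\<Sum>T\<in>Pow {..<p}. exp (\<sigma> * ?Z T))"
    using sum_signs_flip[of "\<lambda>z. exp (\<sigma> * z)" a p]
    by (simp add: cosh_field_def sum.distrib sum_divide_distrib[symmetric])
  also have "\<dots> = (\<Sum>T\<in>Pow {..<p}. exp (\<Sum>j<p. sign_in T j * (\<sigma> * a j)))"
    by (simp add: sum_distrib_left mult_ac)
  also have "\<dots> = 2 ^ p * (\<Prod>j<p. cosh (\<sigma> * a j))"
    unfolding sum_exp_signs by (simp add: prod.distrib)
  also have "(\<Prod>j<p. cosh (\<sigma> * a j)) = (\<Prod>j\<in>D. cosh \<sigma>)"
  proof (rule prod.mono_neutral_cong_right)
    fix j assume "j \<in> D"
    then have "a j = 1 \<or> a j = -1" using a(1)[of j] by linarith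
    then show "cosh (\<sigma> * a j) = cosh \<sigma>" by auto
  qed (use D a fin in auto)
  finally show ?thesis by simp
qed

text \<open>A point of the prior: the pair consists of the support and of the set of positive signs,
  and \<open>l\<close> is the common modulus. Signs are chosen on all of \<open>{..<p}\<close>,
  independently of the support, so the index set is a plain product and each vector is hit equally
  often.\<close>

definition signed_indicator :: "real \<Rightarrow> nat set \<times> nat set \<Rightarrow> nat \<Rightarrow> real" where
  "signed_indicator l x j = (if j \<in> fst x then l * sign_in (snd x) j else 0)"

text \<open>With \<open>x\<close> fixed, averaging over the signs of \<open>y\<close> leaves
  \<open>cosh \<sigma>\<close> to the power of the overlap of the supports; averaging over the
  support of \<open>y\<close> is then \<open>sum_power_card_inter_le\<close> with
  \<open>w = cosh \<sigma> - 1\<close>.\<close>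

lemma sum_signed_indicator_inner_le:
  fixes G :: "real \<Rightarrow> real" and k p :: nat
  defines "I \<equiv> {m. m \<subseteq> {..<p} \<and> card m = k} \<times> Pow {..<p}"
  assumes k: "1 \<le> k" "k \<le> p"
    and G: "\<And>z. \<bar>z\<bar> \<le> real k \<Longrightarrow> (G z + G (- z)) / 2 \<le> cosh (\<sigma> * z)"
  shows "(\<Sum>x\<in>I. \<Sum>y\<in>I. G (\<Sum>j<p. signed_indicator 1 x j * signed_indicator 1 y j))
    \<le> (real (card I))\<^sup>2 * exp ((cosh \<sigma> - 1) * (real k)\<^sup>2 / real p)"
proof -
  let ?M = "{m. m \<subseteq> {..<p} \<and> card m = k}"
  let ?e = "exp ((cosh \<sigma> - 1) * (real k)\<^sup>2 / real p)"
  have cardM: "card ?M = p choose k" using n_subsets[of "{..<p}" k] by simp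
  have cardI: "real (card I) = real (p choose k) * 2 ^ p"
    by (simp add: I_def card_cartesian_product cardM card_Pow)
  have "(\<Sum>y\<in>I. G (\<Sum>j<p. signed_indicator 1 x j * signed_indicator 1 y j)) \<le> real (card I) * ?e" if x: "x \<in> I" for x
  proof -
    obtain m T where mT: "x = (m, T)" "m \<subseteq> {..<p}" "card m = k" using x by (auto simp: I_def)
    have fm: "finite m" using mT finite_subset by blast
    have "(\<Sum>y\<in>I. G (\<Sum>j<p. signed_indicator 1 x j * signed_indicator 1 y j))
      = (\<Sum>m'\<in>?M. \<Sum>T'\<in>Pow {..<p}. G (\<Sum>j<p. signed_indicator 1 x j * signed_indicator 1 (m', T') j))"
      unfolding I_def sum.cartesian_product by (intro sum.cong) auto
    also have "\<dots> = (\<Sum>m'\<in>?M. \<Sum>T'\<in>Pow {..<p}. G (\<Sum>j<p. sign_in T' j * (if j \<in> m \<inter> m' then sign_in T j else 0)))"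
      by (intro sum.cong refl arg_cong[where f = G]) (auto simp: signed_indicator_def mT)
    also have "\<dots> \<le> (\<Sum>m'\<in>?M. 2 ^ p * cosh \<sigma> ^ card (m \<inter> m'))"
    proof (rule sum_mono, rule sum_signs_even_le[OF _ _ G])
      fix m' show "m \<inter> m' \<subseteq> {..<p}" "card (m \<inter> m') \<le> k"
        using mT fm card_mono[of m "m \<inter> m'"] by auto
    qed (auto simp: sign_in_def)
    also have "\<dots> = 2 ^ p * (\<Sum>m'\<in>?M. (1 + (cosh \<sigma> - 1)) ^ card (m \<inter> m'))"
      by (simp add: sum_distrib_left)
    also have "\<dots> \<le> 2 ^ p * (real (p choose k) * ?e)"
      using mT k cosh_real_ge_1[of \<sigma>] by (intro mult_left_mono sum_power_card_inter_le) auto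
    finally show ?thesis by (simp add: cardI mult_ac)
  qed
  then have "(\<Sum>x\<in>I. \<Sum>y\<in>I. G (\<Sum>j<p. signed_indicator 1 x j * signed_indicator 1 y j)) \<le> (\<Sum>x\<in>I. real (card I) * ?e)"
    by (rule sum_mono)
  then show ?thesis by (simp add: power2_eq_square mult_ac)
qed

section \<open>Calibration of the constants and the lower bound\<close>

text \<open>The bound is \<open>1 + 8 * 0.47\<^sup>2\<close>, the value reached at
  \<open>\<alpha> + \<delta> = 0.53\<close>. Splitting the exponent into 32 parts makes the
  quadratic estimate of \<open>exp\<close> precise enough.\<close>

lemma exp_one_less_rational: "exp (1::real) < 2.7672"
proof -
  have "exp (1::real) = exp (1/32) ^ 32"
    using exp_of_nat_mult[of 32 "1/32::real"] by simp
  also have "\<dots> \<le> (1 + 1/32 + (1/32)\<^sup>2) ^ 32"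
    by (intro power_mono exp_bound) auto
  also have "\<dots> < 2.7672" by (simp add: power2_eq_square power_divide)
  finally show ?thesis .
qed

theorem theorem2:
  fixes \<alpha> \<delta> v :: real and k p n :: nat
  assumes "0 < \<alpha>" and "\<alpha> < 1" and "0 < \<delta>" and "\<delta> < 1 - \<alpha>"
    and "1 \<le> k" and "k \<le> p" and "0 < v"
  shows "(\<forall>\<rho>::real. 0 \<le> \<rho> \<and> \<rho> < sqrt (rho2 \<alpha> \<delta> k p n) \<longrightarrow>
            beta_I v n p \<alpha> {\<theta> \<in> Theta_sparse k p. sqnorm p \<theta> < v \<and>
                 sqnorm p \<theta> / (v - sqnorm p \<theta>) = \<rho>\<^sup>2} > \<delta>)
       \<and> (\<alpha> + \<delta> \<le> 0.53 \<longrightarrow>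
            rho2 \<alpha> \<delta> k p n \<ge> real k / (2 * real n)
              * ln (1 + max (real p / (real k)\<^sup>2) (sqrt (real p / (real k)\<^sup>2))))"
proof (intro conjI allI impI)
  define \<eta> where "\<eta> = 1 - \<alpha> - \<delta>"
  have \<eta>: "0 < \<eta>" using assms by (simp add: \<eta>_def)
  define q where "q = real p / (real k)\<^sup>2"
  have q: "0 < q" using assms by (simp add: q_def)
  define L where "L = ln (1 + q + sqrt (2 * q))"
  have kL: "1 \<le> real k * L" using one_le_mult_ln_critical[OF assms(5,6)] by (simp add: L_def q_def)
  define c0 where "c0 = min 1 (ln (1 + 8 * \<eta>\<^sup>2) / 2)"
  have rho2: "rho2 \<alpha> \<delta> k p n = c0 * (real k / real n) * L"
    by (simp add: rho2_def c0_def \<eta>_def L_def q_def)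
  {
    fix \<rho> :: real
    assume \<rho>: "0 \<le> \<rho> \<and> \<rho> < sqrt (rho2 \<alpha> \<delta> k p n)"
    define r where "r = \<rho>\<^sup>2"
    have r: "0 \<le> r" "r < rho2 \<alpha> \<delta> k p n"
      using \<rho> by (auto simp: r_def real_less_rsqrt dest: real_less_lsqrt) (smt (verit) real_sqrt_less_iff real_sqrt_abs)
    \<comment> \<open>For \<open>n = 0\<close> division by zero gives \<open>rho2 = 0\<close>, and
      no \<open>r \<ge> 0\<close> lies below it.\<close>
    have n: "0 < n" using r rho2 by (cases "n = 0") auto
    have k: "0 < real k" using assms by simp
    have L: "0 < L" using kL k by (smt (verit) zero_less_mult_pos)
    define \<tau> where "\<tau> = real n * r / (real k * L)"
    have \<tau>: "0 \<le> \<tau>" "\<tau> < c0" "real n * r = \<tau> * (real k * L)"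
      using r n k L by (auto simp: \<tau>_def rho2 field_simps)
    have \<tau>1: "\<tau> \<le> 1" using \<tau> by (simp add: c0_def)
    \<comment> \<open>From \<open>n * r = \<tau> * k * L\<close>, the argument
      \<open>n * c / sqrt \<tau>\<close> with \<open>c = r * \<bar>z\<bar> / k\<close> becomes
      \<open>\<sigma> * \<bar>z\<bar>\<close>.\<close>
    define \<sigma> where "\<sigma> = sqrt \<tau> * L"
    \<comment> \<open>The squared size of a nonzero entry relative to \<open>v\<close>: with
      \<open>k\<close> such entries the squared norm is \<open>v * r / (1 + r)\<close>, so the
      signal-to-noise ratio is exactly \<open>r\<close>.\<close>
    define a where "a = r / (real k * (1 + r))"
    define G where "G = (\<lambda>z::real. (1 / (1 - a * z)) ^ n)"
    have G: "(G z + G (- z)) / 2 \<le> cosh (\<sigma> * z)" if z: "\<bar>z\<bar> \<le> real k" for z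
    \<comment> \<open>\<open>even_part_le_cosh\<close> needs \<open>\<tau> > 0\<close>; for
      \<open>\<tau> = 0\<close> there is no signal and both sides are one.\<close>
    proof (cases "\<tau> = 0")
      case True
      then have "r = 0" using \<tau>(3) n by simp
      then show ?thesis using True by (simp add: G_def a_def \<sigma>_def)
    next
      case False
      define c where "c = r * \<bar>z\<bar> / real k"
      have c: "0 \<le> c" "c \<le> r" using r k mult_left_mono[OF z r(1)] by (auto simp: c_def field_simps)
      have ac: "c / (1 + r) = a * \<bar>z\<bar>" by (simp add: c_def a_def)
      have "\<tau> * 1 \<le> \<tau> * (real k * L)" using kL \<tau>(1) by (rule mult_left_mono)
      then have "\<tau> \<le> real n * r" using \<tau>(3) by simp
      then have "((1 / (1 - c / (1 + r))) ^ n + (1 / (1 + c / (1 + r))) ^ n) / 2 \<le> cosh (real n * c / sqrt \<tau>)"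
        using c \<tau>(1) \<tau>1 False by (intro even_part_le_cosh) auto
      also have "real n * c / sqrt \<tau> = \<sigma> * \<bar>z\<bar>"
      proof -
        have "real n * c = \<tau> * L * \<bar>z\<bar>" using \<tau>(3) k by (simp add: c_def field_simps)
        then show ?thesis using \<tau>(1) by (simp add: \<sigma>_def real_div_sqrt flip: times_divide_eq_left)
      qed
      also have "cosh (\<sigma> * \<bar>z\<bar>) = cosh (\<sigma> * z)" by (cases "0 \<le> z") auto
      finally show ?thesis unfolding ac G_def by (cases "0 \<le> z") (auto simp: add.commute)
    qed
    define I where "I = {m. m \<subseteq> {..<p} \<and> card m = k} \<times> Pow {..<p}"
    define l where "l = sqrt (v * a)"
    have a0: "0 \<le> a" using r by (simp add: a_def)
    have l: "l\<^sup>2 = v * a" using a0 assms by (simp add: l_def)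
    let ?\<Theta> = "{\<theta> \<in> Theta_sparse k p. sqnorm p \<theta> < v \<and> sqnorm p \<theta> / (v - sqnorm p \<theta>) = \<rho>\<^sup>2}"
    \<comment> \<open>Half the square root of the chi-square bound, so that
      \<open>1 + 4 * t\<^sup>2 = exp \<tau>\<close>.\<close>
    define t where "t = sqrt (exp \<tau> - 1) / 2"
    have "1 - \<alpha> - t \<le> beta_I v n p \<alpha> ?\<Theta>"
    proof (rule beta_I_ge_of_prior[where I = I and th = "signed_indicator l"])
      show "finite I" by (simp add: I_def)
      have "{..<k} \<subseteq> {..<p}" using assms by auto
      then have "({..<k}, {}) \<in> I" by (simp add: I_def)
      then show "I \<noteq> {}" by blast
      show "0 \<le> t" using \<tau>(1) by (simp add: t_def)
    next
      fix x assume "x \<in> I"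
      then obtain m T where x: "x = (m, T)" "m \<subseteq> {..<p}" "card m = k" by (auto simp: I_def)
      have nz: "{j. j < p \<and> signed_indicator l x j \<noteq> 0} \<subseteq> m" by (auto simp: signed_indicator_def x)
      have fm: "finite m" using x finite_subset by blast
      have "sqnorm p (signed_indicator l x) = (\<Sum>j\<in>m. l\<^sup>2)"
        unfolding sqnorm_def using x
        by (intro sum.mono_neutral_cong_right) (auto simp: signed_indicator_def sign_in_def)
      also have "\<dots> = v * (r / (1 + r))" using x k by (simp add: l a_def)
      finally have s: "sqnorm p (signed_indicator l x) = v * (r / (1 + r))" .
      have r1: "v - v * (r / (1 + r)) = v / (1 + r)" using r by (simp add: field_simps)
      have "0 < v / (1 + r)" using assms r by simp
      then have "v * (r / (1 + r)) < v" using r1 by linarith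
      moreover have "v * (r / (1 + r)) / (v - v * (r / (1 + r))) = \<rho>\<^sup>2"
        unfolding r1 using assms r by (simp add: r_def[symmetric])
      moreover have "signed_indicator l x \<in> Theta_sparse k p"
        using card_mono[OF fm nz] x by (auto simp: Theta_sparse_def signed_indicator_def)
      ultimately show "signed_indicator l x \<in> ?\<Theta>" by (simp add: s)
    next
      have inner: "(\<Sum>j<p. signed_indicator l x j * signed_indicator l y j) / v
          = a * (\<Sum>j<p. signed_indicator 1 x j * signed_indicator 1 y j)" for x y
      proof -
        have "(\<Sum>j<p. signed_indicator l x j * signed_indicator l y j)
           = l\<^sup>2 * (\<Sum>j<p. signed_indicator 1 x j * signed_indicator 1 y j)"
          unfolding sum_distrib_left by (intro sum.cong) (auto simp: signed_indicator_def power2_eq_square)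
        then show ?thesis using assms by (simp add: l)
      qed
      have "(\<Sum>x\<in>I. \<Sum>y\<in>I. (1 / (1 - (\<Sum>j<p. signed_indicator l x j * signed_indicator l y j) / v)) ^ n)
        = (\<Sum>x\<in>I. \<Sum>y\<in>I. G (\<Sum>j<p. signed_indicator 1 x j * signed_indicator 1 y j))"
        unfolding inner G_def ..
      also have "\<dots> \<le> (real (card I))\<^sup>2 * exp ((cosh \<sigma> - 1) * (real k)\<^sup>2 / real p)"
        unfolding I_def by (rule sum_signed_indicator_inner_le[OF assms(5,6) G])
      also have "\<dots> \<le> (real (card I))\<^sup>2 * exp \<tau>"
      proof -
        \<comment> \<open>Here the loss \<open>1 / sqrt \<tau>\<close> is recovered: the quadratic
          gain is \<open>\<tau>\<close>, and \<open>cosh L - 1 \<le> q\<close> cancels the factor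
          \<open>k\<^sup>2 / p\<close>.\<close>
        have "cosh \<sigma> - 1 \<le> (sqrt \<tau>)\<^sup>2 * (cosh L - 1)"
          unfolding \<sigma>_def using \<tau>(1) \<tau>1 by (intro cosh_mult_minus_one_le) auto
        also have "\<dots> \<le> \<tau> * q"
          using \<tau>(1) cosh_ln_one_plus_le[of q] q by (simp add: L_def mult_left_mono)
        finally have "(cosh \<sigma> - 1) / q \<le> \<tau>" using q by (simp add: field_simps)
        then have "(cosh \<sigma> - 1) * (real k)\<^sup>2 / real p \<le> \<tau>" by (simp add: q_def)
        then show ?thesis by (intro mult_left_mono) auto
      qed
      also have "exp \<tau> = 1 + 4 * t\<^sup>2" using \<tau>(1) by (simp add: t_def power_divide field_simps)
      finally show "(\<Sum>x\<in>I. \<Sum>y\<in>I. (1 / (1 - (\<Sum>j<p. signed_indicator l x j * signed_indicator l y j) / v)) ^ n)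
        \<le> (real (card I))\<^sup>2 * (1 + 4 * t\<^sup>2)" .
    qed (use assms in auto)
    moreover have "t < \<eta>"
    proof -
      \<comment> \<open>The right side is the square root of \<open>1 + 8 * \<eta>\<^sup>2\<close>,
        which falls short of \<open>1 + 4 * \<eta>\<^sup>2\<close> since squaring the latter adds
        \<open>16 * \<eta>^4\<close>. Strictness comes from \<open>\<tau> < c0\<close>.\<close>
      have "exp \<tau> < exp (ln (1 + 8 * \<eta>\<^sup>2) / 2)" using \<tau>(2) by (simp add: c0_def)
      also have "\<dots> \<le> 1 + 4 * \<eta>\<^sup>2"
      proof (rule power2_le_imp_le)
        have pos: "0 < 1 + 8 * \<eta>\<^sup>2" by (simp add: add_pos_nonneg)
        have "(exp (ln (1 + 8 * \<eta>\<^sup>2) / 2))\<^sup>2 = exp (ln (1 + 8 * \<eta>\<^sup>2))"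
          by (simp add: exp_double[symmetric])
        also have "\<dots> = 1 + 8 * \<eta>\<^sup>2" using pos by simp
        also have "\<dots> \<le> (1 + 4 * \<eta>\<^sup>2)\<^sup>2"
          using zero_le_power2[of "4 * \<eta>\<^sup>2"] unfolding power2_sum by simp
        finally show "(exp (ln (1 + 8 * \<eta>\<^sup>2) / 2))\<^sup>2 \<le> (1 + 4 * \<eta>\<^sup>2)\<^sup>2" .
      qed simp
      finally have "exp \<tau> - 1 < (2 * \<eta>)\<^sup>2" by (simp add: power_mult_distrib)
      then have "sqrt (exp \<tau> - 1) < 2 * \<eta>" using \<eta> by (intro real_less_lsqrt) auto
      then show ?thesis by (simp add: t_def)
    qed
    ultimately show "\<delta> < beta_I v n p \<alpha> ?\<Theta>" by (simp add: \<eta>_def)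
  }
  assume "\<alpha> + \<delta> \<le> 0.53"
  then have "0.47 \<le> \<eta>" by (simp add: \<eta>_def)
  then have "(0.47)\<^sup>2 \<le> \<eta>\<^sup>2" by (intro power_mono) auto
  then have "2.7672 \<le> 1 + 8 * \<eta>\<^sup>2" by (simp add: power2_eq_square)
  then have "exp 1 \<le> 1 + 8 * \<eta>\<^sup>2" using exp_one_less_rational by simp
  then have "1 \<le> ln (1 + 8 * \<eta>\<^sup>2)" by (subst ln_ge_iff) (auto simp: add_pos_nonneg)
  \<comment> \<open>This is the factor \<open>1/2\<close> in \<open>k / (2 * n)\<close>; the
    logarithms compare because a maximum of nonnegative numbers is at most their sum and
    \<open>sqrt q \<le> sqrt (2 * q)\<close>.\<close>
  then have c0: "1/2 \<le> c0" by (simp add: c0_def)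
  have "ln (1 + max q (sqrt q)) \<le> L"
  proof -
    have "sqrt q \<le> sqrt (2 * q)" "0 \<le> sqrt q" using q by auto
    then have "max q (sqrt q) \<le> q + sqrt (2 * q)" "0 < 1 + max q (sqrt q)" using q by linarith+
    then show ?thesis unfolding L_def by (subst ln_le_cancel_iff) linarith+
  qed
  then have "1/2 * (real k / real n) * ln (1 + max q (sqrt q)) \<le> c0 * (real k / real n) * L"
    using c0 q by (intro mult_mono) auto
  then show "real k / (2 * real n) * ln (1 + max (real p / (real k)\<^sup>2) (sqrt (real p / (real k)\<^sup>2))) \<le> rho2 \<alpha> \<delta> k p n"
    by (simp add: rho2 q_def)
qed

end
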